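(* Let $A,B,C$ be trace-zero $3\times 3$ Hermitian matrices, where $A$ has eigenvalues $\lambda_A,\lambda_A,-2\lambda_A$, $B$ has eigenvalues $\lambda_B,\lambda_B,-2\lambda_B$, $C$ has eigenvalues $\lambda_C,\lambda_C,-2\lambda_C$ (real numbers $\lambda_A,\lambda_B\neq 0$; $\lambda_C=0$ means $C=0$), and let $X=A+B+C$. (1) If $C=0$, then the eigenvalues of $X=A+B$ can be labelled $\lambda_1,\lambda_2,\lambda_3$ (not necessarily in order of size) so that $\lambda_1+\lambda_2+\lambda_3=0$, $\lambda_1=\lambda_A+\lambda_B$, and $$\lambda_2\in\begin{cases}[\lambda_A-2\lambda_B,\ \lambda_A+\lambda_B] & \text{if } \lambda_B>0,\\ [\lambda_A+\lambda_B,\ \lambda_A-2\lambda_B] & \text{if } \lambda_B<0.\end{cases}$$ (2) If $A,B,C\neq 0$, then the spectrum of $X$, written in decreasing order $\lambda_1\ge\lambda_2\ge\lambda_3$ as a point of $\mathbb{R}^3$, lies in the convex polytope $P(-3\lambda_A,-3\lambda_B,-3\lambda_C)$ defined in the context. Moreover, in each case, given any triple $(\lambda_1,\lambda_2,\lambda_3)$ satisfying these conditions (in case (1): $\lambda_1+\lambda_2+\lambda_3=0$, $\lambda_1=\lambda_A+\lambda_B$ and $\lambda_2$ in the stated interval; in case (2): $(\lambda_1,\lambda_2,\lambda_3)\in P(-3\lambda_A,-3\lambda_B,-3\lambda_C)$), there are Hermitian matrices $A$ with eigenvalues $\lambda_A,\lambda_A,-2\lambda_A$, $B$ with eigenvalues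 $\lambda_B,\lambda_B,-2\lambda_B$, and $C$ with eigenvalues $\lambda_C,\lambda_C,-2\lambda_C$ ($C=0$ in case (1)), such that $\lambda_1,\lambda_2,\lambda_3$ are the eigenvalues of $A+B+C$.
   Context: Definition of the polytope $P(\Gamma_1,\Gamma_2,\Gamma_3)$ for nonzero real numbers $\Gamma_1,\Gamma_2,\Gamma_3$. It depends only on the unordered triple, so let the labelling be such that $\Gamma_1\ge\Gamma_2\ge\Gamma_3$, and put $s=\Gamma_1+\Gamma_2+\Gamma_3$. For $x\in\mathbb{R}^3$ with $x_1+x_2+x_3=s$ write $[x_1,x_2,x_3]=(x_1-\tfrac s3,\ x_2-\tfrac s3,\ x_3-\tfrac s3)$, a point in the plane of triples with zero sum. Put $a=[s,0,0]$ and $b=[\Gamma_1,\Gamma_2,\Gamma_3]$. If $s\ge 0$, then $P(\Gamma_1,\Gamma_2,\Gamma_3)$ is the convex hull of the following points. - If $\Gamma_3>0$ and $\Gamma_1\le\Gamma_2+\Gamma_3$: $a,\ b,\ [\tfrac s2,\tfrac s2,0],\ [\Gamma_1,\Gamma_1,\Gamma_2+\Gamma_3-\Gamma_1],\ [\Gamma_1+\Gamma_2-\Gamma_3,\Gamma_3,\Gamma_3]$. - If $\Gamma_3>0$ and $\Gamma_1\ge\Gamma_2+\Gamma_3$: $a,\ b,\ [\Gamma_1,\Gamma_2+\Gamma_3,0],\ [\Gamma_1+\Gamma_2-\Gamma_3,\Gamma_3,\Gamma_3]$. - If $\Gamma_3<0<\Gamma_2\le\Gamma_1+\Gamma_3$: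 $a,\ b,\ [\Gamma_1+\Gamma_2,0,\Gamma_3],\ [\Gamma_1+\Gamma_3,\Gamma_2,0]$. - If $\Gamma_2<0$: $a,\ b,\ [\Gamma_1,0,\Gamma_2+\Gamma_3],\ [\Gamma_1-\Gamma_2+\Gamma_3,\Gamma_2,\Gamma_2]$. - If $\Gamma_3<0<\Gamma_2$ and $\Gamma_2\ge\Gamma_1+\Gamma_3$: $a,\ b,\ [\Gamma_1+\Gamma_2,0,\Gamma_3],\ [\Gamma_2,\Gamma_2,\Gamma_1-\Gamma_2+\Gamma_3],\ [\tfrac s2,\tfrac s2,0]$. (These descriptions agree where cases overlap.) If $s<0$, then $P(\Gamma_1,\Gamma_2,\Gamma_3)$ is the image of $P(-\Gamma_1,-\Gamma_2,-\Gamma_3)$ under the involution $*:(\lambda_1,\lambda_2,\lambda_3)\mapsto(-\lambda_3,-\lambda_2,-\lambda_1)$.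
   Formalization: In the converse of case (1) the hypothesis |λ_B| ≤ |λ_A| is added, since as printed it fails whenever |λ_B| > |λ_A| (e.g. λ_A=-1/3, λ_B=-1, triple (-4/3,2/3,2/3)); the other pairs are covered by exchanging A and B. *)

theory Defs
  imports
    "HOL-Analysis.Analysis"
    "Jordan_Normal_Form.Char_Poly"
    "Jordan_Normal_Form.Schur_Decomposition"
begin

definition hermitian :: "complex mat \<Rightarrow> bool" where
  "hermitian M \<longleftrightarrow> mat_adjoint M = M"

text \<open>Eigenvalues are counted with algebraic multiplicity.\<close>

definition eigvals :: "complex mat \<Rightarrow> complex multiset" where
  "eigvals M = proots (char_poly M)"

definition triple :: "real \<Rightarrow> real \<Rightarrow> real \<Rightarrow> complex multiset" where
  "triple x y z = {#complex_of_real x, complex_of_real y, complex_of_real z#}"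

definition hermitian3_with_eigvals :: "complex mat \<Rightarrow> real \<Rightarrow> real \<Rightarrow> real \<Rightarrow> bool" where
  "hermitian3_with_eigvals M x y z \<longleftrightarrow>
     M \<in> carrier_mat 3 3 \<and> hermitian M \<and> eigvals M = triple x y z"

text \<open>The condition on the spectrum of \<open>A + B\<close>, only used for \<open>lB \<noteq> 0\<close>. Despite the
  symmetric roles of \<open>A\<close> and \<open>B\<close> it is not symmetric in \<open>lA\<close> and \<open>lB\<close>. It is always necessary,
  but it is sufficient only for \<open>\<bar>lB\<bar> \<le> \<bar>lA\<bar>\<close>: for \<open>lA = - 1/3\<close>, \<open>lB = - 1\<close> it allows
  \<open>(- 4/3, 2/3, 2/3)\<close>, which would force \<open>trace (A * B) = - 2\<close>, whereas \<open>A = - 1/3 + v v*\<close> and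
  \<open>B = - 1 + 3 w w*\<close> with unit vectors \<open>v\<close>, \<open>w\<close> give
  \<open>trace (A * B) = - 1 + 3 \<bar>(v, w)\<bar>^2 \<ge> - 1\<close>.\<close>

definition two_sum_triple :: "real \<Rightarrow> real \<Rightarrow> real \<Rightarrow> real \<Rightarrow> real \<Rightarrow> bool" where
  "two_sum_triple lA lB l1 l2 l3 \<longleftrightarrow>
     l1 + l2 + l3 = 0 \<and> l1 = lA + lB \<and>
     l2 \<in> (if lB > 0 then {lA - 2 * lB..lA + lB} else {lA + lB..lA - 2 * lB})"

text \<open>The bracket \<open>[x1, x2, x3]\<close>: every triple to which it is applied below has
  coordinate sum \<open>s = g1 + g2 + g3\<close>, so \<open>s\<close> is recovered from the triple itself.\<close>

definition centred :: "real \<Rightarrow> real \<Rightarrow> real \<Rightarrow> real ^ 3" where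
  "centred x1 x2 x3 = (let s = x1 + x2 + x3 in vector [x1 - s / 3, x2 - s / 3, x3 - s / 3])"

text \<open>The polytope for nonzero \<open>g1 \<ge> g2 \<ge> g3\<close> with \<open>g1 + g2 + g3 \<ge> 0\<close>. For such
  parameters the final branch is exactly the case \<open>g3 < 0 < g2\<close>, \<open>g2 > g1 + g3\<close>; on the common
  boundary \<open>g2 = g1 + g3\<close> (and on \<open>g1 = g2 + g3\<close>) both descriptions have the same hull.\<close>

definition polytope_vertices :: "real \<Rightarrow> real \<Rightarrow> real \<Rightarrow> (real ^ 3) set" where
  "polytope_vertices g1 g2 g3 =
    (let s = g1 + g2 + g3; a = centred s 0 0; b = centred g1 g2 g3 in
     if g3 > 0 \<and> g1 \<le> g2 + g3 then
       {a, b, centred (s / 2) (s / 2) 0, centred g1 g1 (g2 + g3 - g1),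
        centred (g1 + g2 - g3) g3 g3}
     else if g3 > 0 \<and> g1 \<ge> g2 + g3 then
       {a, b, centred g1 (g2 + g3) 0, centred (g1 + g2 - g3) g3 g3}
     else if g3 < 0 \<and> 0 < g2 \<and> g2 \<le> g1 + g3 then
       {a, b, centred (g1 + g2) 0 g3, centred (g1 + g3) g2 0}
     else if g2 < 0 then
       {a, b, centred g1 0 (g2 + g3), centred (g1 - g2 + g3) g2 g2}
     else
       {a, b, centred (g1 + g2) 0 g3, centred g2 g2 (g1 - g2 + g3),
        centred (s / 2) (s / 2) 0})"

definition star :: "real ^ 3 \<Rightarrow> real ^ 3" where
  "star l = vector [- vec_nth l 3, - vec_nth l 2, - vec_nth l 1]"

definition polytope_P :: "real \<Rightarrow> real \<Rightarrow> real \<Rightarrow> (real ^ 3) set" where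
  "polytope_P x y z =
    (let gs = rev (sort [x, y, z]); g1 = gs ! 0; g2 = gs ! 1; g3 = gs ! 2 in
     if g1 + g2 + g3 \<ge> 0 then convex hull (polytope_vertices g1 g2 g3)
     else star ` (convex hull (polytope_vertices (- g3) (- g2) (- g1))))"

end

theory Submission
  imports Defs
begin

text \<open>Write \<open>g = - 3 * l\<close> for each of the three parameters and \<open>s\<close> for the sum of the \<open>g\<close>. Then
  \<open>A + B + C + s/3\<close> is a sum \<open>g1 u u* + g2 v v* + g3 w w*\<close> with unit vectors \<open>u, v, w\<close>, and adding
  \<open>s/3\<close> undoes the centring in the polytope. In these coordinates, each sign pattern of
  \<open>(g1, g2, g3)\<close> turns the polytope into a short list of linear inequalities, which does not depend
  on the sign of \<open>s\<close>. Each inequality is necessary by testing the quadratic form on a vector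
  orthogonal to two of the vectors \<open>u, v, w\<close> and the eigenvectors. Conversely, given the
  inequalities, one eigenvalue can be frozen after the second rank one summand, so
  that the matrices are built from two problems about real symmetric \<open>2 \<times> 2\<close> matrices.\<close>

section \<open>The polytope as a system of inequalities\<close>

text \<open>The split by signs reflects inertia: \<open>p\<close> positive and \<open>q\<close>
  negative rank one terms leave at most \<open>p\<close> positive and \<open>q\<close> negative
  eigenvalues. The obstacle to realization is that a rank one update moves all three eigenvalues at
  once. If the new vector is orthogonal to an eigenvector of the first two summands, that eigenvalue
  stays and only a 2x2 block changes. In dimension two, \<open>g u u* + h v v*\<close> has trace
  \<open>g + h\<close> and determinant \<open>g h (1 - |<u, v>|^2)\<close>, so for nonzero
  \<open>g\<close> and \<open>h\<close> a spectrum is attained exactly if it has this trace and its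
  product lies between \<open>0\<close> and \<open>g h\<close>. With one eigenvalue \<open>k\<close>
  frozen, the two determinant conditions factor into differences of eigenvalues and weights, for
  instance \<open>(g1 - k) (g2 - k)\<close>, so that the interlacing inequalities settle them by
  signs alone; which eigenvalue has to be frozen depends on the case. A sum of two matrices is the
  degenerate case of a third weight \<open>0\<close>: two inequalities then pin one eigenvalue to
  \<open>0\<close>, which is \<open>lA + lB\<close> after the shift.\<close>

no_notation vec_index (infixl \<open>$\<close> 100)

text \<open>The spectrum is not centred here: it is that of \<open>A + B + C + s/3\<close>.\<close>

definition weyl_region :: "real \<Rightarrow> real \<Rightarrow> real \<Rightarrow> real \<Rightarrow> real \<Rightarrow> real \<Rightarrow> bool" where
  "weyl_region g1 g2 g3 l1 l2 l3 \<longleftrightarrow> l1 + l2 + l3 = g1 + g2 + g3 \<and> l2 \<le> l1 \<and> l3 \<le> l2 \<and>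
    (if g3 > 0 then g1 \<le> l1 \<and> 0 \<le> l3 \<and> l3 \<le> g3
     else if g2 > 0 then 0 \<le> l2 \<and> l2 \<le> g2 \<and> g3 \<le> l3 \<and> l3 \<le> 0
     else if g1 > 0 then g2 \<le> l2 \<and> l2 \<le> 0 \<and> 0 \<le> l1 \<and> l1 \<le> g1
     else l3 \<le> g3 \<and> g1 \<le> l1 \<and> l1 \<le> 0)"

text \<open>Negation reverses both orders and exchanges the first branch with the last and the
  second with the third. This absorbs the involution for negative weight sums and later reduces the
  sign analysis to \<open>g2 > 0\<close>.\<close>

lemma weyl_region_uminus:
  assumes "g1 \<noteq> 0" "g2 \<noteq> 0" "g3 \<noteq> 0" "g2 \<le> g1" "g3 \<le> g2"
  shows "weyl_region (- g3) (- g2) (- g1) (- l3) (- l2) (- l1) \<longleftrightarrow> weyl_region g1 g2 g3 l1 l2 l3"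
  using assms unfolding weyl_region_def by auto

lemma weyl_region_convex_combination:
  assumes R: "weyl_region g1 g2 g3 a1 a2 a3" "weyl_region g1 g2 g3 b1 b2 b3"
    and uw: "0 \<le> u" "0 \<le> w" "u + w = 1"
  shows "weyl_region g1 g2 g3 (u * a1 + w * b1) (u * a2 + w * b2) (u * a3 + w * b3)"
proof -
  have le: "u * p + w * p' \<le> u * q + w * q'" if "p \<le> q" "p' \<le> q'" for p p' q q'
    using that uw by (intro add_mono mult_left_mono)
  have c: "u * c + w * c = c" for c
    using uw(3) by (metis distrib_right mult_1)
  have lo: "c \<le> u * q + w * q'" if "c \<le> q" "c \<le> q'" for c q q'
    using le[OF that] by (simp only: c)
  have hi: "u * q + w * q' \<le> c" if "q \<le> c" "q' \<le> c" for c q q'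
    using le[OF that] by (simp only: c)
  have "u * a1 + w * b1 + (u * a2 + w * b2) + (u * a3 + w * b3)
    = u * (a1 + a2 + a3) + w * (b1 + b2 + b3)" by (simp add: algebra_simps)
  also have "\<dots> = g1 + g2 + g3"
    using R by (simp add: weyl_region_def c)
  finally have s: "u * a1 + w * b1 + (u * a2 + w * b2) + (u * a3 + w * b3) = g1 + g2 + g3" .
  \<comment> \<open>The branch is selected by the weights alone, so both points satisfy the same
    list of linear inequalities.\<close>
  consider "0 < g3" | "\<not> 0 < g3" "0 < g2" | "\<not> 0 < g3" "\<not> 0 < g2" "0 < g1"
    | "\<not> 0 < g3" "\<not> 0 < g2" "\<not> 0 < g1" by blast
  then show ?thesis
    by cases (use R s in \<open>simp_all only: weyl_region_def if_True if_False le lo hi simp_thms\<close>)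
qed

lemma convex_weyl_region:
  "convex {v :: real ^ 3. weyl_region g1 g2 g3 (v $ 1 + k) (v $ 2 + k) (v $ 3 + k)}"
proof (rule convexI)
  fix x y :: "real ^ 3" and u w :: real
  assume *: "x \<in> {v. weyl_region g1 g2 g3 (v $ 1 + k) (v $ 2 + k) (v $ 3 + k)}"
    "y \<in> {v. weyl_region g1 g2 g3 (v $ 1 + k) (v $ 2 + k) (v $ 3 + k)}" "0 \<le> u" "0 \<le> w" "u + w = 1"
  have k: "u * k + w * k = k" using *(5) by (metis distrib_right mult_1)
  have e: "(u *\<^sub>R x + w *\<^sub>R y) $ i + k = u * (x $ i + k) + w * (y $ i + k)" for i
  proof -
    have "u * (x $ i + k) + w * (y $ i + k) = u * x $ i + w * y $ i + (u * k + w * k)"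
      by (simp add: algebra_simps)
    then show ?thesis by (simp only: k) simp
  qed
  have "weyl_region g1 g2 g3 (x $ 1 + k) (x $ 2 + k) (x $ 3 + k)" "weyl_region g1 g2 g3 (y $ 1 + k) (y $ 2 + k) (y $ 3 + k)"
    using *(1,2) by blast+
  from weyl_region_convex_combination[OF this *(3-5)]
  show "u *\<^sub>R x + w *\<^sub>R y \<in> {v. weyl_region g1 g2 g3 (v $ 1 + k) (v $ 2 + k) (v $ 3 + k)}"
    by (simp only: mem_Collect_eq e)
qed

lemma polytope_vertices_in_weyl_region:
  assumes ord: "g2 \<le> g1" "g3 \<le> g2" and nz: "g1 \<noteq> 0" "g2 \<noteq> 0" "g3 \<noteq> 0" and s: "0 \<le> g1 + g2 + g3"
    and v: "v \<in> polytope_vertices g1 g2 g3"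
  defines "k \<equiv> (g1 + g2 + g3) / 3"
  shows "weyl_region g1 g2 g3 (v $ 1 + k) (v $ 2 + k) (v $ 3 + k)"
proof -
  \<comment> \<open>Every bracket has coordinate sum \<open>g1 + g2 + g3\<close>, so adding
    \<open>k\<close> to each coordinate gives back the uncentred triple, and each vertex becomes a
    check in linear arithmetic.\<close>
  have *: "weyl_region g1 g2 g3 (v $ 1 + k) (v $ 2 + k) (v $ 3 + k)"
    if R: "weyl_region g1 g2 g3 x1 x2 x3" and v: "v = centred x1 x2 x3" for x1 x2 x3
  proof -
    have "(x1 + x2 + x3) / 3 = k" using R by (simp add: weyl_region_def k_def)
    then have "v $ 1 + k = x1" "v $ 2 + k = x2" "v $ 3 + k = x3"
      by (simp_all add: v centred_def Let_def)
    then show ?thesis using R by simp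
  qed
  consider "0 < g3" "g1 \<le> g2 + g3" | "0 < g3" "\<not> g1 \<le> g2 + g3"
    | "g3 < 0" "0 < g2" "g2 \<le> g1 + g3" | "g3 < 0" "0 < g2" "\<not> g2 \<le> g1 + g3" | "g2 < 0"
    using nz by linarith
  then show ?thesis
  proof cases
    case 1
    then consider "v = centred (g1 + g2 + g3) 0 0" | "v = centred g1 g2 g3"
      | "v = centred ((g1 + g2 + g3) / 2) ((g1 + g2 + g3) / 2) 0"
      | "v = centred g1 g1 (g2 + g3 - g1)" | "v = centred (g1 + g2 - g3) g3 g3"
      using v by (auto simp: polytope_vertices_def Let_def)
    then show ?thesis
      by cases (rule *[rotated], assumption, use ord 1 in \<open>simp add: weyl_region_def\<close>)+
  next
    case 2
    then consider "v = centred (g1 + g2 + g3) 0 0" | "v = centred g1 g2 g3"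
      | "v = centred g1 (g2 + g3) 0" | "v = centred (g1 + g2 - g3) g3 g3"
      using v by (auto simp: polytope_vertices_def Let_def)
    then show ?thesis
      by cases (rule *[rotated], assumption, use ord 2 in \<open>simp add: weyl_region_def\<close>)+
  next
    case 3
    then consider "v = centred (g1 + g2 + g3) 0 0" | "v = centred g1 g2 g3"
      | "v = centred (g1 + g2) 0 g3" | "v = centred (g1 + g3) g2 0"
      using v by (auto simp: polytope_vertices_def Let_def)
    then show ?thesis
      by cases (rule *[rotated], assumption, use ord 3 s in \<open>simp add: weyl_region_def\<close>)+
  next
    case 4
    then consider "v = centred (g1 + g2 + g3) 0 0" | "v = centred g1 g2 g3"
      | "v = centred (g1 + g2) 0 g3" | "v = centred g2 g2 (g1 - g2 + g3)"
      | "v = centred ((g1 + g2 + g3) / 2) ((g1 + g2 + g3) / 2) 0"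
      using v by (auto simp: polytope_vertices_def Let_def)
    then show ?thesis
      by cases (rule *[rotated], assumption, use ord 4 s in \<open>simp add: weyl_region_def\<close>)+
  next
    case 5
    then have "g3 < 0" "0 < g1" using ord s by auto
    from 5 this consider "v = centred (g1 + g2 + g3) 0 0" | "v = centred g1 g2 g3"
      | "v = centred g1 0 (g2 + g3)" | "v = centred (g1 - g2 + g3) g2 g2"
      using v by (auto simp: polytope_vertices_def Let_def)
    then show ?thesis
      by cases (rule *[rotated], assumption, use ord 5 s \<open>g3 < 0\<close> \<open>0 < g1\<close> in \<open>simp add: weyl_region_def\<close>)+
  qed
qed

text \<open>Membership along a line needs only two end values. With an arbitrary real interval of
  parameters, a coordinate of the point can itself serve as the parameter.\<close>

lemma convex_affine_path:
  fixes S :: "'a :: real_vector set"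
  assumes "convex S" and aff: "\<And>w a b. f ((1 - w) * a + w * b) = (1 - w) *\<^sub>R f a + w *\<^sub>R f b"
    and "f t0 \<in> S" "f t1 \<in> S" "t0 \<le> t" "t \<le> t1"
  shows "f t \<in> S"
proof (cases "t0 = t1")
  case False
  define w where "w = (t - t0) / (t1 - t0)"
  have w: "0 \<le> w" "w \<le> 1" using assms False by (auto simp: w_def)
  have "w * (t1 - t0) = t - t0" using False by (simp add: w_def)
  then have "t = (1 - w) * t0 + w * t1" by (simp add: algebra_simps)
  then have "f t = (1 - w) *\<^sub>R f t0 + w *\<^sub>R f t1" using aff by simp
  also have "\<dots> \<in> S" using assms w by (intro convexD) auto
  finally show ?thesis .
qed (use assms in auto)

text \<open>Slice the polygon by a coordinate (the last one if all weights are positive, the middle one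
  otherwise): the end points of each slice lie on edges.\<close>

lemma weyl_region_subset_hull:
  assumes ord: "g2 \<le> g1" "g3 \<le> g2" and nz: "g1 \<noteq> 0" "g2 \<noteq> 0" "g3 \<noteq> 0" and s0: "g1 + g2 + g3 \<ge> 0"
    and R: "weyl_region g1 g2 g3 l1 l2 l3"
  shows "centred l1 l2 l3 \<in> convex hull (polytope_vertices g1 g2 g3)"
proof -
  define s where "s = g1 + g2 + g3"
  define S where "S = convex hull (polytope_vertices g1 g2 g3)"
  have S: "convex S" by (simp add: S_def)
  have vert: "v \<in> S" if "v \<in> polytope_vertices g1 g2 g3" for v
    using that by (simp add: S_def hull_inc)
  \<comment> \<open>The coordinate sum is \<open>s\<close>, so two coordinates determine the point,
    and the edges of the polygon become affine paths in the plane.\<close>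
  define C where "C x y = centred x y (s - x - y)" for x y
  have C_aff: "C ((1 - w) * a + w * b) ((1 - w) * c + w * d) = (1 - w) *\<^sub>R C a c + w *\<^sub>R C b d" for w a b c d
    by (simp add: C_def centred_def Let_def Finite_Cartesian_Product.vec_eq_iff forall_3 algebra_simps)
  have path: "C (a1 + t * b1) (a2 + t * b2) \<in> S"
    if "C (a1 + t0 * b1) (a2 + t0 * b2) \<in> S" "C (a1 + t1 * b1) (a2 + t1 * b2) \<in> S" "t0 \<le> t" "t \<le> t1"
    for a1 b1 a2 b2 t0 t1 t
  proof (rule convex_affine_path[where f = "\<lambda>t. C (a1 + t * b1) (a2 + t * b2)", OF S _ that])
    fix w a b
    have "C (a1 + ((1 - w) * a + w * b) * b1) (a2 + ((1 - w) * a + w * b) * b2)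
      = C ((1 - w) * (a1 + a * b1) + w * (a1 + b * b1)) ((1 - w) * (a2 + a * b2) + w * (a2 + b * b2))"
      by (rule arg_cong2[where f = C]) (simp_all add: algebra_simps)
    then show "C (a1 + ((1 - w) * a + w * b) * b1) (a2 + ((1 - w) * a + w * b) * b2) =
         (1 - w) *\<^sub>R C (a1 + a * b1) (a2 + a * b2) + w *\<^sub>R C (a1 + b * b1) (a2 + b * b2)"
      by (simp add: C_aff)
  qed
  have sl: "s = l1 + l2 + l3" using R by (simp add: weyl_region_def s_def)
  have a: "C s 0 \<in> S" and b: "C g1 g2 \<in> S"
    by (auto intro!: vert simp: C_def s_def polytope_vertices_def Let_def)
  consider "g3 > 0" | "g3 < 0" "g2 > 0" | "g2 < 0" "g1 > 0"
    using nz ord s0 by linarith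
  then have "C l1 l2 \<in> S"
  proof cases
    case 1
    have R1: "g1 \<le> l1" "0 \<le> l3" "l3 \<le> g3" "l2 \<le> l1" "l3 \<le> l2"
      using R 1 by (auto simp: weyl_region_def)
    have e: "C (g1 + g2 - g3) g3 \<in> S"
      using 1 by (auto intro!: vert simp: C_def s_def polytope_vertices_def Let_def)
    \<comment> \<open>At height \<open>l3\<close> the largest \<open>l1\<close> occurs for
      \<open>l2 = l3\<close>; these points form the edge from \<open>a\<close> to
      \<open>e\<close>.\<close>
    have right: "C (s - 2 * l3) l3 \<in> S"
      using path[of s 0 "-2" 0 1 g3 l3] a e R1 by (simp add: s_def algebra_simps)
    \<comment> \<open>The least \<open>l1\<close> at height \<open>l3\<close> is dictated by
      \<open>g1 <= l1\<close> and \<open>l2 <= l1\<close>. The two bounds change places at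
      \<open>l3 = g2 + g3 - g1\<close>, the height of the vertex with first two coordinates
      \<open>g1, g1\<close>.\<close>
    have left: "C (max g1 ((s - l3) / 2)) (min (s - g1 - l3) ((s - l3) / 2)) \<in> S"
    proof (cases "g1 \<le> g2 + g3")
      case True
      have c: "C (s / 2) (s / 2) \<in> S" and d: "C g1 g1 \<in> S"
        using 1 True by (auto intro!: vert simp: C_def s_def polytope_vertices_def Let_def field_simps)
      show ?thesis
      proof (cases "l3 \<le> g2 + g3 - g1")
        case True
        have "C (s / 2 + l3 * (- 1 / 2)) (s / 2 + l3 * (- 1 / 2)) \<in> S"
          by (rule path[where ?t0.0 = 0 and ?t1.0 = "g2 + g3 - g1"]) (use True c d R1 in \<open>simp_all add: s_def field_simps\<close>)
        moreover have "g1 \<le> (s - l3) / 2" "(s - l3) / 2 \<le> s - g1 - l3" using True by (auto simp: s_def field_simps)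
        ultimately show ?thesis using d by (simp add: max_absorb2 min_absorb2 diff_divide_distrib)
      next
        case False
        have "C (g1 + l3 * 0) (s - g1 + l3 * (- 1)) \<in> S"
          by (rule path[where ?t0.0 = "g2 + g3 - g1" and ?t1.0 = g3]) (use False b d R1 in \<open>simp_all add: s_def field_simps\<close>)
        moreover have "\<not> g1 \<le> (s - l3) / 2" "s - g1 - l3 \<le> (s - l3) / 2" using False by (auto simp: s_def field_simps)
        ultimately show ?thesis by (simp add: max_def min_def)
      qed
    next
      case False
      then have c: "C g1 (g2 + g3) \<in> S"
        using 1 by (auto intro!: vert simp: C_def s_def polytope_vertices_def Let_def)
      have "C (g1 + l3 * 0) (s - g1 + l3 * (- 1)) \<in> S"
        by (rule path[where ?t0.0 = 0 and ?t1.0 = g3]) (use b c R1 in \<open>simp_all add: s_def algebra_simps\<close>)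
      moreover have "\<not> g1 \<le> (s - l3) / 2" "s - g1 - l3 \<le> (s - l3) / 2" using False R1 by (auto simp: s_def field_simps)
      ultimately show ?thesis by (simp add: max_def min_def)
    qed
    have "C (0 + l1 * 1) (s - l3 + l1 * (- 1)) \<in> S"
    proof (rule path[where ?t0.0 = "max g1 ((s - l3) / 2)" and ?t1.0 = "s - 2 * l3"])
      have "s - l3 - max g1 ((s - l3) / 2) = min (s - g1 - l3) ((s - l3) / 2)"
        by (auto simp: max_def min_def field_simps)
      then show "C (0 + max g1 ((s - l3) / 2) * 1) (s - l3 + max g1 ((s - l3) / 2) * - 1) \<in> S"
        using left by simp
    qed (use right R1 sl in \<open>simp_all add: field_simps\<close>)
    then show ?thesis by (simp add: sl)
  next
    case 2
    have R2: "0 \<le> l2" "l2 \<le> g2" "g3 \<le> l3" "l3 \<le> 0" "l2 \<le> l1" "l3 \<le> l2"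
      using R 2 by (auto simp: weyl_region_def)
    have c: "C (g1 + g2) 0 \<in> S"
      using 2 by (auto intro!: vert simp: C_def s_def polytope_vertices_def Let_def)
    \<comment> \<open>For fixed \<open>l2\<close> the largest \<open>l1\<close> belongs to
      \<open>l3 = g3\<close>, the edge from \<open>c\<close> to \<open>b\<close>.\<close>
    have bottom: "C (s - g3 - l2) l2 \<in> S"
      using path[of "s - g3" 0 "-1" 0 1 g2 l2] b c R2 by (simp add: s_def algebra_simps)
    \<comment> \<open>The least \<open>l1\<close> comes from \<open>l3 <= 0\<close> or from
      \<open>l2 <= l1\<close>; this boundary bends at \<open>l2 = s / 2\<close> if that is below
      \<open>g2\<close>.\<close>
    have top: "C (max (s - l2) l2) l2 \<in> S"
    proof (cases "g2 \<le> g1 + g3")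
      case True
      then have d: "C (g1 + g3) g2 \<in> S"
        using 2 by (auto intro!: vert simp: C_def s_def polytope_vertices_def Let_def)
      have "C (s + l2 * (- 1)) (0 + l2 * 1) \<in> S"
        by (rule path[where ?t0.0 = 0 and ?t1.0 = g2]) (use a d R2 in \<open>simp_all add: s_def algebra_simps\<close>)
      moreover have "l2 \<le> s - l2" using True R2 by (simp add: s_def)
      ultimately show ?thesis by (simp add: max_absorb1)
    next
      case False
      then have d: "C g2 g2 \<in> S" and e: "C (s / 2) (s / 2) \<in> S"
        using 2 by (auto intro!: vert simp: C_def s_def polytope_vertices_def Let_def field_simps)
      show ?thesis
      proof (cases "l2 \<le> s / 2")
        case True
        have "C (s + l2 * (- 1)) (0 + l2 * 1) \<in> S"
          by (rule path[where ?t0.0 = 0 and ?t1.0 = "s / 2"]) (use a e R2 True in \<open>simp_all add: field_simps\<close>)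
        then show ?thesis using True by (simp add: max_absorb1)
      next
        case False
        have "C (0 + l2 * 1) (0 + l2 * 1) \<in> S"
          by (rule path[where ?t0.0 = "s / 2" and ?t1.0 = g2]) (use d e R2 False in \<open>simp_all add: field_simps\<close>)
        then show ?thesis using False by (simp add: max_absorb2)
      qed
    qed
    have "C (0 + l1 * 1) (l2 + l1 * 0) \<in> S"
      by (rule path[where ?t0.0 = "max (s - l2) l2" and ?t1.0 = "s - g3 - l2"])
        (use top bottom R2 sl in simp_all)
    then show ?thesis by simp
  next
    case 3
    have R3: "g2 \<le> l2" "l2 \<le> 0" "l1 \<le> g1" "l2 \<le> l1" "l3 \<le> l2"
      using R 3 ord by (auto simp: weyl_region_def)
    have c: "C g1 0 \<in> S" and d: "C (g1 - g2 + g3) g2 \<in> S"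
      using 3 ord by (auto intro!: vert simp: C_def s_def polytope_vertices_def Let_def)
    have right: "C g1 l2 \<in> S"
      using path[of g1 g2 0 0 1 0 l2] b c R3 by simp
    \<comment> \<open>Here \<open>l3 <= l2\<close> is the active bound: it makes
      \<open>s - 2 * l2\<close> the least \<open>l1\<close>, on the edge from \<open>a\<close> to
      \<open>d\<close>.\<close>
    have left: "C (s - 2 * l2) l2 \<in> S"
      using path[of s g2 "-2" 0 1 0 l2] a d R3 by (simp add: s_def algebra_simps)
    have "C (0 + l1 * 1) (l2 + l1 * 0) \<in> S"
      by (rule path[where ?t0.0 = "s - 2 * l2" and ?t1.0 = g1]) (use left right R3 sl in simp_all)
    then show ?thesis by simp
  qed
  moreover have "s - l1 - l2 = l3" using sl by simp
  ultimately show ?thesis by (simp only: C_def S_def)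
qed

lemma hull_polytope_vertices_iff:
  assumes "g2 \<le> g1" "g3 \<le> g2" "g1 \<noteq> 0" "g2 \<noteq> 0" "g3 \<noteq> 0" "g1 + g2 + g3 \<ge> 0"
  defines "k \<equiv> (g1 + g2 + g3) / 3"
  shows "v \<in> convex hull (polytope_vertices g1 g2 g3) \<longleftrightarrow> weyl_region g1 g2 g3 (v $ 1 + k) (v $ 2 + k) (v $ 3 + k)"
proof
  assume "v \<in> convex hull (polytope_vertices g1 g2 g3)"
  also have "\<dots> \<subseteq> {v. weyl_region g1 g2 g3 (v $ 1 + k) (v $ 2 + k) (v $ 3 + k)}"
    using polytope_vertices_in_weyl_region[OF assms(1-6)] convex_weyl_region
    by (intro hull_minimal) (auto simp: k_def)
  finally show "weyl_region g1 g2 g3 (v $ 1 + k) (v $ 2 + k) (v $ 3 + k)" by simp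
next
  assume R: "weyl_region g1 g2 g3 (v $ 1 + k) (v $ 2 + k) (v $ 3 + k)"
  then have "centred (v $ 1 + k) (v $ 2 + k) (v $ 3 + k) = v"
    by (simp add: centred_def Let_def Finite_Cartesian_Product.vec_eq_iff forall_3 weyl_region_def k_def)
  with weyl_region_subset_hull[OF assms(1-6) R] show "v \<in> convex hull (polytope_vertices g1 g2 g3)"
    by simp
qed

lemma star_star [simp]: "star (star v) = v"
  by (simp only: star_def Finite_Cartesian_Product.vec_eq_iff forall_3 vector_3 minus_minus simp_thms)

lemma star_image_iff: "v \<in> star ` S \<longleftrightarrow> star v \<in> S"
proof
  assume "star v \<in> S"
  then have "star (star v) \<in> star ` S" by (rule imageI)
  then show "v \<in> star ` S" by (simp only: star_star)
next
  assume "v \<in> star ` S"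
  then obtain w where "w \<in> S" "v = star w" by blast
  then show "star v \<in> S" by (simp only: star_star)
qed

text \<open>Both signs of the weight sum give the same inequalities, because \<open>star\<close> is
  negation followed by reversal, under which the region is invariant.\<close>

lemma polytope_P_iff:
  assumes "g2 \<le> g1" "g3 \<le> g2" "g1 \<noteq> 0" "g2 \<noteq> 0" "g3 \<noteq> 0"
  defines "k \<equiv> (g1 + g2 + g3) / 3"
  shows "vector [l1, l2, l3] \<in> polytope_P g1 g2 g3 \<longleftrightarrow> weyl_region g1 g2 g3 (l1 + k) (l2 + k) (l3 + k)"
proof -
  have "sort [g1, g2, g3] = [g3, g2, g1]"
    by (rule properties_for_sort) (use assms in \<open>auto simp: add_mset_commute\<close>)
  then have "rev (sort [g1, g2, g3]) = [g1, g2, g3]" by (simp only: rev.simps append.simps)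
  then have P: "polytope_P g1 g2 g3 = (if g1 + g2 + g3 \<ge> 0 then convex hull (polytope_vertices g1 g2 g3)
      else star ` (convex hull (polytope_vertices (- g3) (- g2) (- g1))))"
    by (simp only: polytope_P_def Let_def) simp
  show ?thesis
  proof (cases "g1 + g2 + g3 \<ge> 0")
    case True
    then show ?thesis
      using assms by (simp add: P hull_polytope_vertices_iff)
  next
    case False
    have "vector [l1, l2, l3] \<in> polytope_P g1 g2 g3 \<longleftrightarrow>
      star (vector [l1, l2, l3]) \<in> convex hull (polytope_vertices (- g3) (- g2) (- g1))"
      unfolding P if_not_P[OF False] by (rule star_image_iff)
    also have "\<dots> \<longleftrightarrow> weyl_region (- g3) (- g2) (- g1) (- (l3 + k)) (- (l2 + k)) (- (l1 + k))"
    proof -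
      have k': "(- g3 + - g2 + - g1) / 3 = - k"
      proof -
        have "g1 + g2 + g3 = k * 3" by (simp add: k_def)
        then have "- g3 + - g2 + - g1 = (- k) * 3" by linarith
        then show ?thesis by simp
      qed
      have "star (vector [l1, l2, l3]) \<in> convex hull (polytope_vertices (- g3) (- g2) (- g1)) \<longleftrightarrow>
        weyl_region (- g3) (- g2) (- g1) (- l3 + - k) (- l2 + - k) (- l1 + - k)"
        using assms False hull_polytope_vertices_iff[of "- g2" "- g3" "- g1" "star (vector [l1, l2, l3])"]
        unfolding k' star_def vector_3 by simp
      then show ?thesis by (simp only: minus_add_distrib)
    qed
    also have "\<dots> \<longleftrightarrow> weyl_region g1 g2 g3 (l1 + k) (l2 + k) (l3 + k)"
      using assms(1-5) by (intro weyl_region_uminus)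
    finally show ?thesis .
  qed
qed

lemma polytope_P_permute:
  assumes "mset [x, y, z] = mset [x', y', z']"
  shows "polytope_P x y z = polytope_P x' y' z'"
proof -
  have "sort [x, y, z] = sort [x', y', z']"
    by (rule properties_for_sort) (simp_all only: mset_sort sorted_sort assms)
  then show ?thesis by (simp only: polytope_P_def)
qed

section \<open>Unitary diagonalization of Hermitian matrices\<close>

no_notation vec_nth (infixl \<open>$\<close> 90)
no_notation inner (infixl \<open>\<bullet>\<close> 70)
notation vec_index (infixl \<open>$\<close> 100)

section \<open>Adjoints and inner products of complex matrices\<close>

lemma dim_mat_adjoint [simp]:
  "dim_row (mat_adjoint A) = dim_col A" "dim_col (mat_adjoint A) = dim_row A"
  by (simp_all add: mat_adjoint_def)

lemma mat_adjoint_index [simp]: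
  "i < dim_col A \<Longrightarrow> j < dim_row A \<Longrightarrow> mat_adjoint A $$ (i, j) = conjugate (A $$ (j, i))"
  by (simp add: mat_adjoint_def mat_of_rows_def)

lemma mat_adjoint_carrier [simp]: "A \<in> carrier_mat m n \<Longrightarrow> mat_adjoint A \<in> carrier_mat n m"
  by (auto intro: carrier_matI)

lemma mat_adjoint_adjoint [simp]: "mat_adjoint (mat_adjoint (A :: complex mat)) = A"
  by (rule eq_matI) auto

lemma mat_adjoint_mult:
  fixes A B :: "complex mat"
  assumes "A \<in> carrier_mat l m" "B \<in> carrier_mat m n"
  shows "mat_adjoint (A * B) = mat_adjoint B * mat_adjoint A"
  using assms by (intro eq_matI) (auto simp: scalar_prod_def mult.commute)

lemma cscalar_prod_mat_adjoint:
  fixes A :: "complex mat"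
  assumes A: "A \<in> carrier_mat m n" and x: "x \<in> carrier_vec n" and y: "y \<in> carrier_vec m"
  shows "(A *\<^sub>v x) \<bullet>c y = x \<bullet>c (mat_adjoint A *\<^sub>v y)"
proof -
  have "(A *\<^sub>v x) \<bullet>c y = (\<Sum>i<m. \<Sum>j<n. A $$ (i, j) * x $ j * cnj (y $ i))"
    using A x y by (simp add: scalar_prod_def sum_distrib_right atLeast0LessThan)
  also have "\<dots> = (\<Sum>j<n. \<Sum>i<m. A $$ (i, j) * x $ j * cnj (y $ i))"
    by (rule sum.swap)
  also have "\<dots> = x \<bullet>c (mat_adjoint A *\<^sub>v y)"
    using A x y by (simp add: scalar_prod_def sum_distrib_left atLeast0LessThan mult_ac)
  finally show ?thesis .
qed

text \<open>Complete \<open>v\<close> to a basis and orthogonalize: Gram-Schmidt leaves the first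
  vector unchanged, so normalization turns it into a multiple of \<open>v\<close>.\<close>

lemma unitary_first_column:
  fixes v :: "complex vec"
  assumes v: "v \<in> carrier_vec n" and v0: "v \<noteq> 0\<^sub>v n"
  obtains W c where "W \<in> carrier_mat n n" "mat_adjoint W * W = 1\<^sub>m n" "W * mat_adjoint W = 1\<^sub>m n"
    "col W 0 = c \<cdot>\<^sub>v v"
proof -
  interpret cof_vec_space n "TYPE(complex)" .
  define ws where "ws = gram_schmidt n (basis_completion v)"
  note bc = basis_completion[OF v v0]
  note gs = gram_schmidt_result[OF bc(2) bc(4) bc(5) ws_def]
  have len: "length ws = n" using gs bc by simp
  have n: "n > 0" using v v0 by (metis neq0_conv eq_vecI carrier_vecD not_less0 index_zero_vec(2))
  have ws0: "ws ! 0 = v"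
  proof -
    have "hd ws = v"
      unfolding ws_def using bc(7) bc(6) n v
      by (cases "basis_completion v") auto
    then show ?thesis using len n hd_conv_nth[of ws] by auto
  qed
  have wsc: "ws ! i \<in> carrier_vec n" if "i < n" for i
    using gs(3) len that by auto
  \<comment> \<open>Gram-Schmidt yields orthogonal vectors of arbitrary length; \<open>r i\<close>
    is the normalizing factor.\<close>
  define r where "r i = complex_of_real (1 / sqrt (Re (ws ! i \<bullet>c ws ! i)))" for i
  define W where "W = mat_of_cols n (map (\<lambda>i. r i \<cdot>\<^sub>v ws ! i) [0..<n])"
  have W: "W \<in> carrier_mat n n" by (auto simp: W_def)
  have colW: "col W i = r i \<cdot>\<^sub>v ws ! i" if "i < n" for i
    using that wsc by (simp add: W_def)
  have norm: "cnj (r i) * r i * (ws ! i \<bullet>c ws ! i) = 1" if i: "i < n" for i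
  proof -
    have "ws ! i \<bullet>c ws ! i \<noteq> 0" "ws ! i \<bullet>c ws ! i \<ge> 0"
      using gs(2) i len by (auto simp: corthogonalD)
    then have "ws ! i \<bullet>c ws ! i = of_real (Re (ws ! i \<bullet>c ws ! i))" "Re (ws ! i \<bullet>c ws ! i) > 0"
      by (auto simp: complex_eq_iff less_eq_complex_def)
    then obtain t where "ws ! i \<bullet>c ws ! i = of_real t" "t > 0" by metis
    then show ?thesis
      by (simp add: r_def flip: of_real_mult)
  qed
  have WW: "mat_adjoint W * W = 1\<^sub>m n"
  proof (rule eq_matI)
    fix i j assume "i < dim_row (1\<^sub>m n :: complex mat)" "j < dim_col (1\<^sub>m n :: complex mat)"
    then have ij: "i < n" "j < n" by auto
    have row: "row (mat_adjoint W) i = conjugate (col W i)"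
      using W ij by (intro eq_vecI) auto
    have "(mat_adjoint W * W) $$ (i, j) = conjugate (col W i) \<bullet> col W j"
      using W ij by (simp add: row)
    also have "\<dots> = col W j \<bullet>c col W i"
      using W ij by (metis conjugate_vec_sprod_comm col_dim carrier_matD(1))
    also have "\<dots> = r j * (cnj (r i) * (ws ! j \<bullet>c ws ! i))"
      using ij wsc[of i] wsc[of j] by (simp add: colW conjugate_smult_vec smult_scalar_prod_distrib[of _ n] scalar_prod_smult_distrib[of _ n])
    also have "\<dots> = 1\<^sub>m n $$ (i, j)"
      using ij norm[of i] corthogonalD[OF gs(2), of j i] len
      by (cases "i = j") (auto simp: mult_ac)
    finally show "(mat_adjoint W * W) $$ (i, j) = 1\<^sub>m n $$ (i, j)" .
  qed (use W in auto)
  have "W * mat_adjoint W = 1\<^sub>m n"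
    using mat_mult_left_right_inverse[OF mat_adjoint_carrier[OF W] W WW] .
  with W WW colW[OF n] ws0 show ?thesis by (intro that) auto
qed

section \<open>Block matrices and the spectral theorem\<close>

lemma mult_block_diag_mat:
  fixes A1 A2 B1 B2 :: "'a :: comm_ring_1 mat"
  assumes "A1 \<in> carrier_mat k k" "A2 \<in> carrier_mat k k" "B1 \<in> carrier_mat m m" "B2 \<in> carrier_mat m m"
  shows "four_block_mat A1 (0\<^sub>m k m) (0\<^sub>m m k) B1 * four_block_mat A2 (0\<^sub>m k m) (0\<^sub>m m k) B2
    = four_block_mat (A1 * A2) (0\<^sub>m k m) (0\<^sub>m m k) (B1 * B2)"
  using assms
  by (subst mult_four_block_mat[of _ k k _ m _ m _ _ k _ m]) auto

lemma adjoint_block_diag_mat: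
  fixes A B :: "complex mat"
  assumes "A \<in> carrier_mat k k" "B \<in> carrier_mat m m"
  shows "mat_adjoint (four_block_mat A (0\<^sub>m k m) (0\<^sub>m m k) B)
    = four_block_mat (mat_adjoint A) (0\<^sub>m k m) (0\<^sub>m m k) (mat_adjoint B)"
  using assms by (intro eq_matI) auto

lemma four_block_one_mat: "four_block_mat (1\<^sub>m k) (0\<^sub>m k m) (0\<^sub>m m k) (1\<^sub>m m) = (1\<^sub>m (k + m) :: 'a :: zero_neq_one mat)"
  by (rule eq_matI) auto

text \<open>Deflation: in a unitary basis that starts with an eigenvector, the first column is
  \<open>e\<close> followed by zeros. Hermitian symmetry clears the first row as well, and the
  remaining Hermitian block has the characteristic polynomial with one linear factor removed. The
  list \<open>es\<close> is complex here; that its entries are real is derived afterwards.\<close>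

lemma hermitian_unitarily_diagonalizable:
  fixes H :: "complex mat"
  assumes "H \<in> carrier_mat n n" "mat_adjoint H = H" "char_poly H = (\<Prod>e\<leftarrow>es. [:- e, 1:])"
  shows "\<exists>U\<in>carrier_mat n n. mat_adjoint U * U = 1\<^sub>m n \<and> U * mat_adjoint U = 1\<^sub>m n \<and>
    H = U * mat_diag n (\<lambda>i. es ! i) * mat_adjoint U"
  using assms
proof (induction es arbitrary: n H)
  case Nil
  then have "n = 0"
    using degree_monic_char_poly[OF Nil(1)] by simp
  with Nil show ?case
    by (intro bexI[of _ H]) (auto intro!: eq_matI)
next
  case (Cons e es)
  note H = Cons.prems(1) and adH = Cons.prems(2) and cp = Cons.prems(3)
  have "n = length (e # es)"
    using degree_monic_char_poly[OF H] degree_linear_factors[of uminus "e # es"] cp by simp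
  then obtain m where n: "n = Suc m" by simp
  have "eigenvalue H e"
    using eigenvalue_root_char_poly[OF H, of e] cp by simp
  then obtain v where "eigenvector H v e" by (auto simp: eigenvalue_def)
  then have v: "v \<in> carrier_vec n" "v \<noteq> 0\<^sub>v n" "H *\<^sub>v v = e \<cdot>\<^sub>v v"
    using H by (auto simp: eigenvector_def)
  obtain W c where W: "W \<in> carrier_mat n n" and W1: "mat_adjoint W * W = 1\<^sub>m n"
    and W2: "W * mat_adjoint W = 1\<^sub>m n" and colW: "col W 0 = c \<cdot>\<^sub>v v"
    using unitary_first_column[OF v(1,2)] by blast
  note W' = mat_adjoint_carrier[OF W]
  define M where "M = mat_adjoint W * H * W"
  have M: "M \<in> carrier_mat n n" using W W' H by (auto simp: M_def)
  have "mat_adjoint W * H \<in> carrier_mat n n" using W' H by simp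
  then have adM: "mat_adjoint M = M"
    using W W' H by (simp add: M_def mat_adjoint_mult[of _ n n _ n] adH assoc_mult_mat[of _ n n _ n _ n])
  have HM: "H = W * M * mat_adjoint W"
  proof -
    have "W * M * mat_adjoint W = (W * mat_adjoint W) * H * (W * mat_adjoint W)"
      unfolding M_def using W W' H
      by (simp add: assoc_mult_mat[of _ n n _ n _ n] mult_carrier_mat[of _ n n _ n])
    then show ?thesis using H by (simp add: W2)
  qed
  have col0: "col M 0 = e \<cdot>\<^sub>v unit_vec n 0"
  proof -
    have HW: "H * W \<in> carrier_mat n n" using H W by simp
    have "M = mat_adjoint W * (H * W)"
      unfolding M_def by (rule assoc_mult_mat[OF W' H W])
    then have "col M 0 = mat_adjoint W *\<^sub>v col (H * W) 0"
      using col_mult2[OF W' HW] n by (simp del: col_mult2)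
    also have "col (H * W) 0 = H *\<^sub>v col W 0"
      using col_mult2[OF H W] n by blast
    also have "H *\<^sub>v col W 0 = e \<cdot>\<^sub>v col W 0"
      using H v by (simp add: colW mult_mat_vec smult_smult_assoc mult.commute)
    also have "mat_adjoint W *\<^sub>v (e \<cdot>\<^sub>v col W 0) = e \<cdot>\<^sub>v col (mat_adjoint W * W) 0"
    proof -
      have "col W 0 \<in> carrier_vec n" using W by (intro carrier_vecI) simp
      from mult_mat_vec[OF W' this] show ?thesis using col_mult2[OF W' W, of 0] n by (simp del: col_mult2)
    qed
    finally show ?thesis using n by (simp add: W1)
  qed
  have M0: "M $$ (i, 0) = (if i = 0 then e else 0)" if "i < n" for i
    using arg_cong[OF col0, of "\<lambda>w. w $ i"] that M n by simp
  have M0': "M $$ (0, j) = (if j = 0 then e else 0)" if "j < n" for j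
  proof (cases "j = 0")
    case False
    have "M $$ (0, j) = cnj (M $$ (j, 0))"
      using arg_cong[OF adM, of "\<lambda>A. A $$ (0, j)"] M that n by simp
    then show ?thesis using M0[OF that] False by simp
  qed (use M0 n in auto)
  define K where "K = mat m m (\<lambda>(i, j). M $$ (Suc i, Suc j))"
  have K: "K \<in> carrier_mat m m" by (simp add: K_def)
  define E where "E = mat 1 1 (\<lambda>_. e)"
  have E: "E \<in> carrier_mat 1 1" by (simp add: E_def)
  have MK: "M = four_block_mat E (0\<^sub>m 1 m) (0\<^sub>m m 1) K"
    using M M0 M0' n by (intro eq_matI) (auto simp: E_def K_def)
  have adK: "mat_adjoint K = K"
  proof (rule eq_matI)
    fix i j assume "i < dim_row K" "j < dim_col K"
    then show "mat_adjoint K $$ (i, j) = K $$ (i, j)"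
      using arg_cong[OF adM, of "\<lambda>A. A $$ (Suc i, Suc j)"] M n by (simp add: K_def)
  qed (simp_all add: K_def)
  have "similar_mat H M"
    unfolding similar_mat_def similar_mat_wit_def
    using H M W W' W1 W2 HM by - (rule exI[of _ W], rule exI[of _ "mat_adjoint W"], simp add: Let_def mult_carrier_mat[of _ n n _ n])
  then have "char_poly H = char_poly M" by (rule char_poly_similar)
  also have "\<dots> = char_poly E * char_poly K"
    unfolding MK by (rule char_poly_four_block_zeros_col[OF E zero_carrier_mat K])
  finally have "char_poly H = char_poly E * char_poly K" .
  moreover have "char_poly E = [:- e, 1:]"
    by (subst char_poly_upper_triangular[OF E]) (auto simp: E_def diag_mat_def)
  ultimately have "[:- e, 1:] * char_poly K = [:- e, 1:] * (\<Prod>e\<leftarrow>es. [:- e, 1:])"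
    using cp by simp
  then have "char_poly K = (\<Prod>e\<leftarrow>es. [:- e, 1:])"
    by (subst (asm) mult_cancel_left) simp
  from Cons.IH[OF K adK this] obtain V where V: "V \<in> carrier_mat m m"
    and V1: "mat_adjoint V * V = 1\<^sub>m m" and V2: "V * mat_adjoint V = 1\<^sub>m m"
    and KV: "K = V * mat_diag m (\<lambda>i. es ! i) * mat_adjoint V" by blast
  note V' = mat_adjoint_carrier[OF V]
  define Z where "Z = four_block_mat (1\<^sub>m 1) (0\<^sub>m 1 m) (0\<^sub>m m 1) V"
  have Z: "Z \<in> carrier_mat n n" using V n by (auto simp: Z_def)
  have adZ: "mat_adjoint Z = four_block_mat (1\<^sub>m 1) (0\<^sub>m 1 m) (0\<^sub>m m 1) (mat_adjoint V)"
  proof -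
    have "mat_adjoint (1\<^sub>m 1) = (1\<^sub>m 1 :: complex mat)" by (rule eq_matI) auto
    then show ?thesis using V by (simp add: Z_def adjoint_block_diag_mat)
  qed
  note Z' = mat_adjoint_carrier[OF Z]
  have Z1: "mat_adjoint Z * Z = 1\<^sub>m n" "Z * mat_adjoint Z = 1\<^sub>m n"
    unfolding adZ unfolding Z_def using V V' V1 V2 n four_block_one_mat[of 1 m]
    by (simp_all add: mult_block_diag_mat)
  define D where "D = mat_diag n (\<lambda>i. (e # es) ! i)"
  have D: "D \<in> carrier_mat n n" by (simp add: D_def)
  have "D = four_block_mat E (0\<^sub>m 1 m) (0\<^sub>m m 1) (mat_diag m (\<lambda>i. es ! i))"
    unfolding D_def by (rule eq_matI) (auto simp: mat_diag_def E_def n nth_Cons')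
  then have MZ: "M = Z * D * mat_adjoint Z"
    unfolding adZ unfolding Z_def MK KV using V V' E
    by (simp add: mult_block_diag_mat mult_carrier_mat[of _ m m _ m])
  note assoc = assoc_mult_mat[of _ n n _ n _ n] mult_carrier_mat[of _ n n _ n]
  define U where "U = W * Z"
  have U: "U \<in> carrier_mat n n" using W Z by (simp add: U_def)
  have adU: "mat_adjoint U = mat_adjoint Z * mat_adjoint W"
    using W Z by (simp add: U_def mat_adjoint_mult)
  have "mat_adjoint U * U = mat_adjoint Z * (mat_adjoint W * W) * Z"
    unfolding adU unfolding U_def using W W' Z Z' by (simp add: assoc)
  then have U1: "mat_adjoint U * U = 1\<^sub>m n" by (simp only: W1 right_mult_one_mat[OF Z'] Z1)
  have "H = U * D * mat_adjoint U"
    unfolding adU unfolding U_def HM MZ using W W' Z Z' D by (simp add: assoc)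
  then show ?case
    using U U1 mat_mult_left_right_inverse[OF mat_adjoint_carrier[OF U] U U1] D_def by blast
qed

section \<open>Quadratic forms in an orthonormal eigenbasis\<close>

definition herm_form :: "complex mat \<Rightarrow> complex vec \<Rightarrow> real" where
  "herm_form H x = Re ((H *\<^sub>v x) \<bullet>c x)"

definition norm_sq :: "complex vec \<Rightarrow> real" where
  "norm_sq x = Re (x \<bullet>c x)"

lemma Re_mult_cnj: "Re (z * cnj z) = (cmod z)\<^sup>2"
  by (simp add: cmod_power2 flip: power2_eq_square)

lemma norm_sq_eq_sum: "norm_sq x = (\<Sum>i<dim_vec x. (cmod (x $ i))\<^sup>2)"
proof -
  have "norm_sq x = Re (\<Sum>i<dim_vec x. x $ i * cnj (x $ i))"
    by (simp add: norm_sq_def scalar_prod_def atLeast0LessThan)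
  then show ?thesis by (simp only: Re_sum Re_mult_cnj)
qed

lemma lessThan_3: "{..<3::nat} = {0, 1, 2}" by auto

lemma mat_adjoint_mult_vec_index:
  fixes U :: "complex mat"
  assumes "U \<in> carrier_mat n n" "x \<in> carrier_vec n" "i < n"
  shows "(mat_adjoint U *\<^sub>v x) $ i = x \<bullet>c col U i"
  using assms by (auto simp: scalar_prod_def mult.commute intro!: sum.cong)

lemma norm_sq_unitary:
  fixes U :: "complex mat"
  assumes "U \<in> carrier_mat n n" "U * mat_adjoint U = 1\<^sub>m n" "x \<in> carrier_vec n"
  shows "norm_sq (mat_adjoint U *\<^sub>v x) = norm_sq x"
proof -
  have "(mat_adjoint U *\<^sub>v x) \<bullet>c (mat_adjoint U *\<^sub>v x) = (U *\<^sub>v (mat_adjoint U *\<^sub>v x)) \<bullet>c x"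
    using assms by (subst cscalar_prod_mat_adjoint[of U n n]) (auto intro!: mult_mat_vec_carrier[of _ n n])
  also have "U *\<^sub>v (mat_adjoint U *\<^sub>v x) = x"
    using assms assoc_mult_mat_vec[of U n n "mat_adjoint U" n x] by simp
  finally show ?thesis by (simp add: norm_sq_def)
qed

lemma herm_form_unitary_diag:
  fixes U :: "complex mat"
  assumes U: "U \<in> carrier_mat n n" and x: "x \<in> carrier_vec n"
  shows "herm_form (U * mat_diag n (\<lambda>i. complex_of_real (d i)) * mat_adjoint U) x
    = (\<Sum>i<n. d i * (cmod (x \<bullet>c col U i))\<^sup>2)"
proof -
  define D where "D = mat_diag n (\<lambda>i. complex_of_real (d i))"
  have D: "D \<in> carrier_mat n n" by (simp add: D_def)
  define z where "z = mat_adjoint U *\<^sub>v x"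
  have z: "z \<in> carrier_vec n" using U x by (auto simp: z_def intro!: mult_mat_vec_carrier[of _ n n])
  have Dz: "(D *\<^sub>v z) $ i = of_real (d i) * z $ i" if "i < n" for i
  proof -
    have "(D *\<^sub>v z) $ i = (\<Sum>j = 0..<n. (if i = j then of_real (d j) else 0) * z $ j)"
      using D z that by (simp add: scalar_prod_def D_def mat_diag_def)
    also have "\<dots> = (\<Sum>j = 0..<n. if i = j then of_real (d j) * z $ j else 0)"
      by (rule sum.cong) auto
    finally show ?thesis using that by simp
  qed
  have "(U * D * mat_adjoint U) *\<^sub>v x = U *\<^sub>v (D *\<^sub>v z)"
    using U D x by (simp add: z_def assoc_mult_mat_vec[of _ n n _ n] assoc_mult_mat[of _ n n _ n _ n] mult_carrier_mat[of _ n n _ n])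
  then have "((U * D * mat_adjoint U) *\<^sub>v x) \<bullet>c x = (D *\<^sub>v z) \<bullet>c z"
    using cscalar_prod_mat_adjoint[OF U, of "D *\<^sub>v z" x] D z x by (simp add: z_def)
  also have "\<dots> = (\<Sum>i<n. of_real (d i) * (z $ i * cnj (z $ i)))"
    using D z Dz by (simp add: scalar_prod_def atLeast0LessThan mult.assoc)
  finally have "herm_form (U * D * mat_adjoint U) x = (\<Sum>i<n. Re (of_real (d i) * (z $ i * cnj (z $ i))))"
    by (simp only: herm_form_def Re_sum)
  also have "\<dots> = (\<Sum>i<n. d i * Re (z $ i * cnj (z $ i)))"
    by (rule sum.cong) auto
  also have "\<dots> = (\<Sum>i<n. d i * (cmod (x \<bullet>c col U i))\<^sup>2)"
    by (rule sum.cong) (simp_all only: Re_mult_cnj z_def mat_adjoint_mult_vec_index[OF U x] lessThan_iff)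
  finally show ?thesis by (simp add: D_def)
qed

text \<open>Undoing the conjugation by \<open>U\<close> shows that the diagonal matrix is itself
  Hermitian, so its diagonal entries equal their conjugates.\<close>

lemma hermitian_eigenvalues_real:
  fixes H U :: "complex mat"
  assumes U: "U \<in> carrier_mat n n" and U1: "mat_adjoint U * U = 1\<^sub>m n"
    and H: "H = U * mat_diag n d * mat_adjoint U" and adH: "mat_adjoint H = H" and i: "i < n"
  shows "cnj (d i) = d i"
proof -
  note U' = mat_adjoint_carrier[OF U]
  define D where "D = mat_diag n d"
  have D: "D \<in> carrier_mat n n" by (simp add: D_def)
  note mc = mult_carrier_mat[of _ n n _ n]
  have Hc: "H \<in> carrier_mat n n" using U by (auto simp: H)
  have "mat_adjoint U * H * U = (mat_adjoint U * U) * D * (mat_adjoint U * U)"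
    unfolding H D_def[symmetric] using U U' D by (simp add: assoc_mult_mat[of _ n n _ n _ n] mc)
  then have "D = mat_adjoint U * H * U" using D by (simp add: U1)
  then have "mat_adjoint D = D"
    using U U' Hc by (simp add: mat_adjoint_mult[of _ n n _ n] adH assoc_mult_mat[of _ n n _ n _ n] mc)
  from arg_cong[OF this, of "\<lambda>A. A $$ (i, i)"] show ?thesis
    using i D by (simp add: D_def mat_diag_def)
qed

lemma prod_list_linear_factors_mset:
  fixes as bs :: "complex list"
  assumes "mset as = mset bs"
  shows "(\<Prod>a\<leftarrow>as. [:- a, 1:]) = (\<Prod>a\<leftarrow>bs. [:- a, 1:])"
  using arg_cong[OF assms, of "\<lambda>M. \<Prod>a\<in>#M. [:- a, 1:]"]
  by (simp flip: prod_mset_prod_list mset_map)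

lemma proots_linear_factors:
  fixes as :: "complex list"
  shows "proots (\<Prod>a\<leftarrow>as. [:- a, 1:]) = mset as"
proof (induction as)
  case (Cons a as)
  have "(\<Prod>a\<leftarrow>as. [:- a, 1:]) \<noteq> 0" by (auto simp: prod_list_zero_iff)
  then have "proots ([:- a, 1:] * (\<Prod>a\<leftarrow>as. [:- a, 1:])) = {#a#} + mset as"
    using Cons by (subst proots_mult) auto
  then show ?case by (simp only: list.map prod_list.Cons) simp
qed simp

text \<open>These two identities are all that the eigenvalue estimates use about a matrix: its form
  and the norm, both expressed in an orthonormal eigenbasis.\<close>

lemma hermitian3_spectral:
  assumes "hermitian3_with_eigvals H a b c"
  obtains U where "U \<in> carrier_mat 3 3" "mat_adjoint U * U = 1\<^sub>m 3" "U * mat_adjoint U = 1\<^sub>m 3"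
    "\<forall>x\<in>carrier_vec 3. herm_form H x =
      a * (cmod (x \<bullet>c col U 0))\<^sup>2 + b * (cmod (x \<bullet>c col U 1))\<^sup>2 + c * (cmod (x \<bullet>c col U 2))\<^sup>2"
    "\<forall>x\<in>carrier_vec 3. norm_sq x =
      (cmod (x \<bullet>c col U 0))\<^sup>2 + (cmod (x \<bullet>c col U 1))\<^sup>2 + (cmod (x \<bullet>c col U 2))\<^sup>2"
proof -
  have H: "H \<in> carrier_mat 3 3" and adH: "mat_adjoint H = H" and ev: "proots (char_poly H) = triple a b c"
    using assms by (auto simp: hermitian3_with_eigvals_def hermitian_def eigvals_def)
  define es where "es = map complex_of_real [a, b, c]"
  obtain as where as: "char_poly H = (\<Prod>a\<leftarrow>as. [:- a, 1:])"
    using char_poly_factorized[OF H] by blast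
  \<comment> \<open>The factorization lists the eigenvalues in some order; equality of multisets
    allows them to be relisted as \<open>a, b, c\<close>, so that the columns of \<open>U\<close>
    correspond to them in this order.\<close>
  then have "mset as = mset es"
    using ev by (simp add: proots_linear_factors triple_def es_def)
  then have "char_poly H = (\<Prod>a\<leftarrow>es. [:- a, 1:])"
    using as prod_list_linear_factors_mset by metis
  from hermitian_unitarily_diagonalizable[OF H adH this] obtain U
    where U: "U \<in> carrier_mat 3 3" "mat_adjoint U * U = 1\<^sub>m 3" "U * mat_adjoint U = 1\<^sub>m 3"
      "H = U * mat_diag 3 (\<lambda>i. es ! i) * mat_adjoint U" by blast
  have "mat_diag 3 (\<lambda>i. es ! i) = mat_diag 3 (\<lambda>i. complex_of_real ([a, b, c] ! i))"
    unfolding mat_diag_def by (rule eq_matI) (auto simp: es_def nth_Cons')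
  then have HU: "H = U * mat_diag 3 (\<lambda>i. complex_of_real ([a, b, c] ! i)) * mat_adjoint U"
    using U by simp
  show thesis
  proof (rule that[OF U(1-3)]; rule ballI)
    fix x :: "complex vec" assume x: "x \<in> carrier_vec 3"
    show "herm_form H x =
      a * (cmod (x \<bullet>c col U 0))\<^sup>2 + b * (cmod (x \<bullet>c col U 1))\<^sup>2 + c * (cmod (x \<bullet>c col U 2))\<^sup>2"
      unfolding HU herm_form_unitary_diag[OF U(1) x] by (simp add: lessThan_3)
    have "norm_sq x = norm_sq (mat_adjoint U *\<^sub>v x)"
      using norm_sq_unitary[OF U(1,3) x] by simp
    also have "\<dots> = (\<Sum>i<3. (cmod ((mat_adjoint U *\<^sub>v x) $ i))\<^sup>2)"
      using U(1) by (simp add: norm_sq_eq_sum)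
    also have "\<dots> = (\<Sum>i<3. (cmod (x \<bullet>c col U i))\<^sup>2)"
      by (rule sum.cong) (simp_all only: mat_adjoint_mult_vec_index[OF U(1) x] lessThan_iff)
    finally show "norm_sq x =
      (cmod (x \<bullet>c col U 0))\<^sup>2 + (cmod (x \<bullet>c col U 1))\<^sup>2 + (cmod (x \<bullet>c col U 2))\<^sup>2"
      by (simp add: lessThan_3)
  qed
qed

lemma hermitian3_ordered_eigvals:
  assumes H: "H \<in> carrier_mat 3 3" and herm: "hermitian H"
  obtains l1 l2 l3 where "l1 \<ge> l2" "l2 \<ge> l3" "hermitian3_with_eigvals H l1 l2 l3"
proof -
  have adH: "mat_adjoint H = H" using herm by (simp add: hermitian_def)
  obtain as where as: "char_poly H = (\<Prod>a\<leftarrow>as. [:- a, 1:])" "length as = 3"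
    using char_poly_factorized[OF H] by blast
  from hermitian_unitarily_diagonalizable[OF H adH as(1)] obtain U
    where U: "U \<in> carrier_mat 3 3" "mat_adjoint U * U = 1\<^sub>m 3"
      "H = U * mat_diag 3 (\<lambda>i. as ! i) * mat_adjoint U" by blast
  define ls where "ls = sort (map Re as)"
  have "map (complex_of_real \<circ> Re) as = as"
  proof (rule nth_equalityI)
    fix i assume "i < length (map (complex_of_real \<circ> Re) as)"
    then have "cnj (as ! i) = as ! i" "i < length as"
      using hermitian_eigenvalues_real[OF U adH, of i] as(2) by auto
    then show "map (complex_of_real \<circ> Re) as ! i = as ! i" by (simp add: complex_eq_iff)
  qed simp
  then have mset_as: "mset as = image_mset complex_of_real (mset ls)"
    by (metis ls_def mset_sort mset_map list.map_comp)
  have "length ls = 3" "sorted ls" using as(2) by (simp_all add: ls_def)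
  then obtain l1 l2 l3 where ls: "ls = [l3, l2, l1]" "l3 \<le> l2" "l2 \<le> l1"
    by (auto simp: numeral_3_eq_3 length_Suc_conv)
  have "eigvals H = triple l1 l2 l3"
    by (simp add: eigvals_def as(1) proots_linear_factors mset_as ls triple_def)
  with H herm ls that show thesis by (simp add: hermitian3_with_eigvals_def)
qed

lemma norm_sq_col_unitary:
  assumes "U \<in> carrier_mat n n" "mat_adjoint U * U = 1\<^sub>m n" "i < n"
  shows "norm_sq (col U i) = 1"
proof -
  have "col U i \<bullet>c col U i = (mat_adjoint U *\<^sub>v col U i) $ i"
    using assms by (intro mat_adjoint_mult_vec_index[symmetric]) auto
  also have "mat_adjoint U *\<^sub>v col U i = col (mat_adjoint U * U) i"
    using assms col_mult2[of "mat_adjoint U" n n U n i] by (simp del: col_mult2)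
  finally show ?thesis using assms by (simp add: norm_sq_def)
qed

text \<open>With \<open>u\<close> a unit eigenvector for \<open>- 2 * l\<close>, the matrix is
  \<open>l - 3 l u u*\<close>: since the other two eigenvalues agree, their coordinates enter only
  through the norm.\<close>

lemma rank_one_form:
  assumes "hermitian3_with_eigvals A l l (- 2 * l)"
  obtains u where "u \<in> carrier_vec 3" "norm_sq u = 1"
    "\<forall>x\<in>carrier_vec 3. herm_form A x = l * norm_sq x - 3 * l * (cmod (x \<bullet>c u))\<^sup>2"
proof -
  obtain U where U: "U \<in> carrier_mat 3 3" "mat_adjoint U * U = 1\<^sub>m 3" "U * mat_adjoint U = 1\<^sub>m 3"
    and F: "\<forall>x\<in>carrier_vec 3. herm_form A x =
      l * (cmod (x \<bullet>c col U 0))\<^sup>2 + l * (cmod (x \<bullet>c col U 1))\<^sup>2 + (- 2 * l) * (cmod (x \<bullet>c col U 2))\<^sup>2"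
    and N: "\<forall>x\<in>carrier_vec 3. norm_sq x =
      (cmod (x \<bullet>c col U 0))\<^sup>2 + (cmod (x \<bullet>c col U 1))\<^sup>2 + (cmod (x \<bullet>c col U 2))\<^sup>2"
    by (rule hermitian3_spectral[OF assms])
  show thesis
  proof (rule that)
    show "col U 2 \<in> carrier_vec 3" using U(1) by (simp add: carrier_vecI)
    show "norm_sq (col U 2) = 1" using norm_sq_col_unitary[OF U(1,2)] by simp
    show "\<forall>x\<in>carrier_vec 3. herm_form A x = l * norm_sq x - 3 * l * (cmod (x \<bullet>c col U 2))\<^sup>2"
    proof
      fix x :: "complex vec" assume x: "x \<in> carrier_vec 3"
      show "herm_form A x = l * norm_sq x - 3 * l * (cmod (x \<bullet>c col U 2))\<^sup>2"
        unfolding bspec[OF F x] bspec[OF N x] by (simp add: algebra_simps)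
    qed
  qed
qed

lemma herm_form_add:
  assumes "A \<in> carrier_mat n n" "B \<in> carrier_mat n n" "x \<in> carrier_vec n"
  shows "herm_form (A + B) x = herm_form A x + herm_form B x"
  using assms by (simp add: herm_form_def add_mult_distrib_mat_vec[of _ n n] add_scalar_prod_distrib[of _ n])

lemma hermitian_add:
  assumes "A \<in> carrier_mat n n" "B \<in> carrier_mat n n" "hermitian A" "hermitian B"
  shows "hermitian (A + B)"
proof -
  have "mat_adjoint (A + B) = mat_adjoint A + mat_adjoint B"
    using assms(1,2) by (intro eq_matI) auto
  then show ?thesis using assms by (simp add: hermitian_def)
qed

lemma sum_unit_vec_cscalar_prod:
  assumes "u \<in> carrier_vec 3"
  shows "(\<Sum>i<3. (cmod (unit_vec 3 i \<bullet>c u))\<^sup>2) = norm_sq u"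
  using assms by (simp add: norm_sq_eq_sum)

lemma perp_to_first_column_and:
  fixes U :: "complex mat"
  assumes U: "U \<in> carrier_mat 3 3" "mat_adjoint U * U = 1\<^sub>m 3" "U * mat_adjoint U = 1\<^sub>m 3"
    and w: "w \<in> carrier_vec 3"
  obtains x where "x \<in> carrier_vec 3" "x \<bullet>c w = 0" "norm_sq x > 0" "x \<bullet>c col U 0 = 0"
proof -
  define z where "z = mat_adjoint U *\<^sub>v w"
  have z: "z \<in> carrier_vec 3" using U w by (auto simp: z_def intro!: mult_mat_vec_carrier[of _ 3 3])
  \<comment> \<open>In the basis of columns of \<open>U\<close>, the first coordinate has to vanish
    and \<open>(p, q)\<close> solves the one remaining equation. For \<open>z $ 1 = 0\<close> the
    generic solution might be zero, so \<open>(1, 0)\<close> replaces it.\<close>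
  define p q where "p = (if z $ 1 = 0 then 1 else cnj (z $ 2))" and "q = (if z $ 1 = 0 then 0 else - cnj (z $ 1))"
  define y where "y = vec 3 (\<lambda>m. if m = 1 then p else if m = 2 then q else 0)"
  have y: "y \<in> carrier_vec 3" by (simp add: y_def)
  define x where "x = U *\<^sub>v y"
  have x: "x \<in> carrier_vec 3" using U y by (auto simp: x_def intro!: mult_mat_vec_carrier[of _ 3 3])
  have Ux: "mat_adjoint U *\<^sub>v x = y"
    using U y assoc_mult_mat_vec[of "mat_adjoint U" 3 3 U 3 y] by (simp add: x_def)
  have "x \<bullet>c w = y \<bullet>c z"
    unfolding x_def z_def using U(1) y w by (rule cscalar_prod_mat_adjoint)
  also have "\<dots> = (\<Sum>m<3. y $ m * cnj (z $ m))"
    using z by (simp add: scalar_prod_def atLeast0LessThan)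
  also have "\<dots> = p * cnj (z $ 1) + q * cnj (z $ 2)"
    by (simp add: lessThan_3 y_def)
  also have "\<dots> = 0" by (simp add: p_def q_def)
  finally have xw: "x \<bullet>c w = 0" .
  have "norm_sq x = norm_sq y"
    using norm_sq_unitary[OF U(1,3) x] Ux by simp
  also have "\<dots> = (\<Sum>m<3. (cmod (y $ m))\<^sup>2)"
    using y by (simp add: norm_sq_eq_sum)
  also have "\<dots> = (cmod p)\<^sup>2 + (cmod q)\<^sup>2"
    by (simp add: lessThan_3 y_def)
  also have "\<dots> > 0" by (cases "z $ 1 = 0") (auto simp: p_def q_def add_nonneg_pos)
  finally have "norm_sq x > 0" .
  moreover have "x \<bullet>c col U 0 = 0"
    using mat_adjoint_mult_vec_index[OF U(1) x, of 0] unfolding Ux by (simp add: y_def)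
  ultimately show thesis using x xw that by blast
qed

text \<open>Two linear conditions in dimension three leave a nonzero solution. The detour through a
  unitary basis also covers parallel vectors and \<open>w = 0\<close>, where a cross product would
  vanish.\<close>

lemma perp_to_two:
  fixes v w :: "complex vec"
  assumes v: "v \<in> carrier_vec 3" "norm_sq v = 1" and w: "w \<in> carrier_vec 3"
  obtains x where "x \<in> carrier_vec 3" "x \<bullet>c v = 0" "x \<bullet>c w = 0" "norm_sq x > 0"
proof -
  have "v \<noteq> 0\<^sub>v 3" using v by (auto simp: norm_sq_def)
  then obtain W c where W: "W \<in> carrier_mat 3 3" "mat_adjoint W * W = 1\<^sub>m 3" "W * mat_adjoint W = 1\<^sub>m 3"
    and col: "col W 0 = c \<cdot>\<^sub>v v" using unitary_first_column[OF v(1)] by metis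
  obtain x where x: "x \<in> carrier_vec 3" "x \<bullet>c w = 0" "norm_sq x > 0" "x \<bullet>c col W 0 = 0"
    using perp_to_first_column_and[OF W w] by blast
  have "norm_sq (col W 0) = 1" using norm_sq_col_unitary[OF W(1,2)] by simp
  then have "c \<noteq> 0" using v by (auto simp: col norm_sq_def)
  moreover have "x \<bullet>c col W 0 = cnj c * (x \<bullet>c v)"
    using x v by (simp add: col conjugate_smult_vec scalar_prod_smult_distrib[of _ 3])
  ultimately show thesis using x that by simp
qed

section \<open>Eigenvalue inequalities for sums of rank one matrices\<close>

definition unit3 :: "complex vec set" where
  "unit3 = {u \<in> carrier_vec 3. norm_sq u = 1}"

lemma norm_sq_nonneg: "norm_sq x \<ge> 0"
  by (simp add: norm_sq_eq_sum sum_nonneg)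

lemma cscalar_prod_unit_le:
  assumes x: "x \<in> carrier_vec 3" and u: "u \<in> unit3"
  shows "(cmod (x \<bullet>c u))\<^sup>2 \<le> norm_sq x"
proof -
  have u': "u \<in> carrier_vec 3" "norm_sq u = 1" using u by (auto simp: unit3_def)
  have "cmod (x \<bullet>c u) = cmod (\<Sum>i<3. x $ i * cnj (u $ i))"
    using x u' by (simp add: scalar_prod_def atLeast0LessThan)
  also have "\<dots> \<le> (\<Sum>i<3. \<bar>cmod (x $ i)\<bar> * \<bar>cmod (u $ i)\<bar>)"
    by (rule order_trans[OF norm_sum]) (simp add: norm_mult)
  also have "\<dots> \<le> L2_set (\<lambda>i. cmod (x $ i)) {..<3} * L2_set (\<lambda>i. cmod (u $ i)) {..<3}"
    by (rule L2_set_mult_ineq)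
  also have "\<dots> = sqrt (norm_sq x)"
    using x u' by (simp add: L2_set_def norm_sq_eq_sum)
  finally have "(cmod (x \<bullet>c u))\<^sup>2 \<le> (sqrt (norm_sq x))\<^sup>2" by (rule power_mono) simp
  then show ?thesis by (simp add: norm_sq_nonneg)
qed

text \<open>\<open>l1, l2, l3\<close> are the eigenvalues of \<open>g1 u1 u1* + g2 u2 u2* + g3 u3 u3*\<close>, stated through quadratic
  forms; the first equation says that the unit eigenvectors \<open>y1, y2, y3\<close> are orthonormal.\<close>

definition rank_one_sum_spectrum :: "real \<Rightarrow> real \<Rightarrow> real \<Rightarrow> real \<Rightarrow> real \<Rightarrow> real \<Rightarrow> bool" where
  "rank_one_sum_spectrum g1 g2 g3 l1 l2 l3 \<longleftrightarrow> (\<exists>u1 u2 u3 y1 y2 y3.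
    u1 \<in> unit3 \<and> u2 \<in> unit3 \<and> u3 \<in> unit3 \<and> y1 \<in> unit3 \<and> y2 \<in> unit3 \<and> y3 \<in> unit3 \<and>
    (\<forall>x\<in>carrier_vec 3. norm_sq x = (cmod (x \<bullet>c y1))\<^sup>2 + (cmod (x \<bullet>c y2))\<^sup>2 + (cmod (x \<bullet>c y3))\<^sup>2) \<and>
    (\<forall>x\<in>carrier_vec 3. l1 * (cmod (x \<bullet>c y1))\<^sup>2 + l2 * (cmod (x \<bullet>c y2))\<^sup>2 + l3 * (cmod (x \<bullet>c y3))\<^sup>2
      = g1 * (cmod (x \<bullet>c u1))\<^sup>2 + g2 * (cmod (x \<bullet>c u2))\<^sup>2 + g3 * (cmod (x \<bullet>c u3))\<^sup>2))"

lemma rank_one_sum_spectrumI: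
  assumes "u1 \<in> unit3" "u2 \<in> unit3" "u3 \<in> unit3" "y1 \<in> unit3" "y2 \<in> unit3" "y3 \<in> unit3"
    and "\<And>x. x \<in> carrier_vec 3 \<Longrightarrow> norm_sq x = (cmod (x \<bullet>c y1))\<^sup>2 + (cmod (x \<bullet>c y2))\<^sup>2 + (cmod (x \<bullet>c y3))\<^sup>2"
    and "\<And>x. x \<in> carrier_vec 3 \<Longrightarrow> l1 * (cmod (x \<bullet>c y1))\<^sup>2 + l2 * (cmod (x \<bullet>c y2))\<^sup>2 + l3 * (cmod (x \<bullet>c y3))\<^sup>2
      = g1 * (cmod (x \<bullet>c u1))\<^sup>2 + g2 * (cmod (x \<bullet>c u2))\<^sup>2 + g3 * (cmod (x \<bullet>c u3))\<^sup>2"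
  shows "rank_one_sum_spectrum g1 g2 g3 l1 l2 l3"
  unfolding rank_one_sum_spectrum_def
  by (rule exI[of _ u1], rule exI[of _ u2], rule exI[of _ u3], rule exI[of _ y1], rule exI[of _ y2],
      rule exI[of _ y3], intro conjI ballI assms)

lemma rank_one_sum_spectrumE:
  assumes "rank_one_sum_spectrum g1 g2 g3 l1 l2 l3"
  obtains u1 u2 u3 y1 y2 y3 where "u1 \<in> unit3" "u2 \<in> unit3" "u3 \<in> unit3" "y1 \<in> unit3" "y2 \<in> unit3" "y3 \<in> unit3"
    "\<forall>x\<in>carrier_vec 3. norm_sq x = (cmod (x \<bullet>c y1))\<^sup>2 + (cmod (x \<bullet>c y2))\<^sup>2 + (cmod (x \<bullet>c y3))\<^sup>2"
    "\<forall>x\<in>carrier_vec 3. l1 * (cmod (x \<bullet>c y1))\<^sup>2 + l2 * (cmod (x \<bullet>c y2))\<^sup>2 + l3 * (cmod (x \<bullet>c y3))\<^sup>2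
      = g1 * (cmod (x \<bullet>c u1))\<^sup>2 + g2 * (cmod (x \<bullet>c u2))\<^sup>2 + g3 * (cmod (x \<bullet>c u3))\<^sup>2"
  using assms unfolding rank_one_sum_spectrum_def by (elim exE conjE) (rule that)

text \<open>Together with the other transposition this allows the weights to be sorted, and a zero
  weight to be put where a bound needs it.\<close>

lemma rank_one_sum_spectrum_swap12:
  assumes "rank_one_sum_spectrum g1 g2 g3 l1 l2 l3"
  shows "rank_one_sum_spectrum g2 g1 g3 l1 l2 l3"
proof -
  obtain u1 u2 u3 y1 y2 y3 where un: "u1 \<in> unit3" "u2 \<in> unit3" "u3 \<in> unit3" "y1 \<in> unit3" "y2 \<in> unit3" "y3 \<in> unit3"
    and N': "\<forall>x\<in>carrier_vec 3. norm_sq x = (cmod (x \<bullet>c y1))\<^sup>2 + (cmod (x \<bullet>c y2))\<^sup>2 + (cmod (x \<bullet>c y3))\<^sup>2"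
    and F': "\<forall>x\<in>carrier_vec 3. l1 * (cmod (x \<bullet>c y1))\<^sup>2 + l2 * (cmod (x \<bullet>c y2))\<^sup>2 + l3 * (cmod (x \<bullet>c y3))\<^sup>2
      = g1 * (cmod (x \<bullet>c u1))\<^sup>2 + g2 * (cmod (x \<bullet>c u2))\<^sup>2 + g3 * (cmod (x \<bullet>c u3))\<^sup>2"
    by (rule rank_one_sum_spectrumE[OF assms(1)])
  note N = bspec[OF N'] and F = bspec[OF F']
  show ?thesis
    by (rule rank_one_sum_spectrumI[OF un(2,1,3,4-6)], drule N, linarith, drule F, linarith)
qed

lemma rank_one_sum_spectrum_swap23:
  assumes "rank_one_sum_spectrum g1 g2 g3 l1 l2 l3"
  shows "rank_one_sum_spectrum g1 g3 g2 l1 l2 l3"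
proof -
  obtain u1 u2 u3 y1 y2 y3 where un: "u1 \<in> unit3" "u2 \<in> unit3" "u3 \<in> unit3" "y1 \<in> unit3" "y2 \<in> unit3" "y3 \<in> unit3"
    and N': "\<forall>x\<in>carrier_vec 3. norm_sq x = (cmod (x \<bullet>c y1))\<^sup>2 + (cmod (x \<bullet>c y2))\<^sup>2 + (cmod (x \<bullet>c y3))\<^sup>2"
    and F': "\<forall>x\<in>carrier_vec 3. l1 * (cmod (x \<bullet>c y1))\<^sup>2 + l2 * (cmod (x \<bullet>c y2))\<^sup>2 + l3 * (cmod (x \<bullet>c y3))\<^sup>2
      = g1 * (cmod (x \<bullet>c u1))\<^sup>2 + g2 * (cmod (x \<bullet>c u2))\<^sup>2 + g3 * (cmod (x \<bullet>c u3))\<^sup>2"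
    by (rule rank_one_sum_spectrumE[OF assms(1)])
  note N = bspec[OF N'] and F = bspec[OF F']
  show ?thesis
    by (rule rank_one_sum_spectrumI[OF un(1,3,2,4-6)], drule N, linarith, drule F, linarith)
qed

lemma rank_one_sum_spectrum_uminus:
  assumes "rank_one_sum_spectrum g1 g2 g3 l1 l2 l3"
  shows "rank_one_sum_spectrum (- g3) (- g2) (- g1) (- l3) (- l2) (- l1)"
proof -
  obtain u1 u2 u3 y1 y2 y3 where un: "u1 \<in> unit3" "u2 \<in> unit3" "u3 \<in> unit3" "y1 \<in> unit3" "y2 \<in> unit3" "y3 \<in> unit3"
    and N': "\<forall>x\<in>carrier_vec 3. norm_sq x = (cmod (x \<bullet>c y1))\<^sup>2 + (cmod (x \<bullet>c y2))\<^sup>2 + (cmod (x \<bullet>c y3))\<^sup>2"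
    and F': "\<forall>x\<in>carrier_vec 3. l1 * (cmod (x \<bullet>c y1))\<^sup>2 + l2 * (cmod (x \<bullet>c y2))\<^sup>2 + l3 * (cmod (x \<bullet>c y3))\<^sup>2
      = g1 * (cmod (x \<bullet>c u1))\<^sup>2 + g2 * (cmod (x \<bullet>c u2))\<^sup>2 + g3 * (cmod (x \<bullet>c u3))\<^sup>2"
    by (rule rank_one_sum_spectrumE[OF assms(1)])
  note N = bspec[OF N'] and F = bspec[OF F']
  show ?thesis
    by (rule rank_one_sum_spectrumI[OF un(3,2,1,6,5,4)], drule N, linarith, drule F, linarith)
qed

text \<open>Sum the identity of forms over the standard basis: each unit vector then contributes its
  coefficient exactly once.\<close>

lemma rank_one_sum_spectrum_trace:
  assumes "rank_one_sum_spectrum g1 g2 g3 l1 l2 l3"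
  shows "l1 + l2 + l3 = g1 + g2 + g3"
proof -
  obtain u1 u2 u3 y1 y2 y3 where un: "u1 \<in> unit3" "u2 \<in> unit3" "u3 \<in> unit3" "y1 \<in> unit3" "y2 \<in> unit3" "y3 \<in> unit3"
    and N': "\<forall>x\<in>carrier_vec 3. norm_sq x = (cmod (x \<bullet>c y1))\<^sup>2 + (cmod (x \<bullet>c y2))\<^sup>2 + (cmod (x \<bullet>c y3))\<^sup>2"
    and F': "\<forall>x\<in>carrier_vec 3. l1 * (cmod (x \<bullet>c y1))\<^sup>2 + l2 * (cmod (x \<bullet>c y2))\<^sup>2 + l3 * (cmod (x \<bullet>c y3))\<^sup>2
      = g1 * (cmod (x \<bullet>c u1))\<^sup>2 + g2 * (cmod (x \<bullet>c u2))\<^sup>2 + g3 * (cmod (x \<bullet>c u3))\<^sup>2"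
    by (rule rank_one_sum_spectrumE[OF assms(1)])
  note N = bspec[OF N'] and F = bspec[OF F']
  have tr: "(\<Sum>i<3. a * (cmod (unit_vec 3 i \<bullet>c v1))\<^sup>2 + b * (cmod (unit_vec 3 i \<bullet>c v2))\<^sup>2 + c * (cmod (unit_vec 3 i \<bullet>c v3))\<^sup>2) = a + b + c"
    if "v1 \<in> unit3" "v2 \<in> unit3" "v3 \<in> unit3" for a b c :: real and v1 v2 v3
    using that unfolding sum.distrib sum_distrib_left[symmetric]
    by (simp only: unit3_def mem_Collect_eq sum_unit_vec_cscalar_prod mult_1_right)
  show ?thesis
    using tr[OF un(4-6), of l1 l2 l3] tr[OF un(1-3), of g1 g2 g3] F[OF unit_vec_carrier] by simp
qed

text \<open>Test vectors: \<open>u1\<close> gives \<open>g1 <= l1\<close>, the eigenvector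
  \<open>y3\<close> gives \<open>0 <= l3\<close>, and a vector orthogonal to \<open>u1\<close> and
  \<open>u2\<close> gives \<open>l3 <= g3\<close>. Weights may vanish, as the sum of two matrices
  requires.\<close>

lemma rank_one_sum_spectrum_nonneg:
  assumes "rank_one_sum_spectrum g1 g2 g3 l1 l2 l3" and l: "l2 \<le> l1" "l3 \<le> l2"
    and g: "0 \<le> g1" "0 \<le> g2" "0 \<le> g3"
  shows "g1 \<le> l1" "0 \<le> l3" "l3 \<le> g3"
proof -
  obtain u1 u2 u3 y1 y2 y3 where un: "u1 \<in> unit3" "u2 \<in> unit3" "u3 \<in> unit3" "y1 \<in> unit3" "y2 \<in> unit3" "y3 \<in> unit3"
    and N': "\<forall>x\<in>carrier_vec 3. norm_sq x = (cmod (x \<bullet>c y1))\<^sup>2 + (cmod (x \<bullet>c y2))\<^sup>2 + (cmod (x \<bullet>c y3))\<^sup>2"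
    and F': "\<forall>x\<in>carrier_vec 3. l1 * (cmod (x \<bullet>c y1))\<^sup>2 + l2 * (cmod (x \<bullet>c y2))\<^sup>2 + l3 * (cmod (x \<bullet>c y3))\<^sup>2
      = g1 * (cmod (x \<bullet>c u1))\<^sup>2 + g2 * (cmod (x \<bullet>c u2))\<^sup>2 + g3 * (cmod (x \<bullet>c u3))\<^sup>2"
    by (rule rank_one_sum_spectrumE[OF assms(1)])
  note N = bspec[OF N'] and F = bspec[OF F']
  have car: "u \<in> carrier_vec 3" "norm_sq u = 1" if "u \<in> unit3" for u
    using that by (auto simp: unit3_def)
  have uu: "(cmod (u \<bullet>c u))\<^sup>2 = 1" if "u \<in> unit3" for u
  proof -
    have "u \<bullet>c u = of_real (Re (u \<bullet>c u))"
      using conjugate_square_ge_0_vec[of u] by (auto simp: complex_eq_iff less_eq_complex_def)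
    then show ?thesis using car[OF that] by (metis norm_sq_def norm_one of_real_1 one_power2)
  qed
  have up: "g1 * (cmod (x \<bullet>c u1))\<^sup>2 + g2 * (cmod (x \<bullet>c u2))\<^sup>2 + g3 * (cmod (x \<bullet>c u3))\<^sup>2 \<le> l1 * norm_sq x"
    and lo: "l3 * norm_sq x \<le> g1 * (cmod (x \<bullet>c u1))\<^sup>2 + g2 * (cmod (x \<bullet>c u2))\<^sup>2 + g3 * (cmod (x \<bullet>c u3))\<^sup>2"
    if x: "x \<in> carrier_vec 3" for x
    using l unfolding F[OF x, symmetric] N[OF x] by (auto simp: distrib_left intro!: add_mono mult_right_mono)
  show "g1 \<le> l1"
  proof -
    have "g1 \<le> g1 * (cmod (u1 \<bullet>c u1))\<^sup>2 + g2 * (cmod (u1 \<bullet>c u2))\<^sup>2 + g3 * (cmod (u1 \<bullet>c u3))\<^sup>2"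
      using g by (simp add: uu[OF un(1)])
    also have "\<dots> \<le> l1" using up[OF car(1)[OF un(1)]] car(2)[OF un(1)] by simp
    finally show ?thesis .
  qed
  \<comment> \<open>At \<open>y3\<close> the three squares add up to \<open>1\<close> and the last
    one alone is already \<open>1\<close>, so the other two vanish.\<close>
  have y3: "y3 \<bullet>c y1 = 0" "y3 \<bullet>c y2 = 0"
    using N[OF car(1)[OF un(6)]] car(2)[OF un(6)] uu[OF un(6)]
    by (auto simp: add_nonneg_eq_0_iff)
  show "0 \<le> l3"
    using F[OF car(1)[OF un(6)]] g by (simp add: y3 uu[OF un(6)])
  obtain x where x: "x \<in> carrier_vec 3" "x \<bullet>c u1 = 0" "x \<bullet>c u2 = 0" "norm_sq x > 0"
    using perp_to_two car un by metis
  have "l3 * norm_sq x \<le> g3 * (cmod (x \<bullet>c u3))\<^sup>2" using lo[OF x(1)] x by simp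
  also have "\<dots> \<le> g3 * norm_sq x" using cscalar_prod_unit_le[OF x(1) un(3)] g by (simp add: mult_left_mono)
  finally show "l3 \<le> g3" using x by simp
qed

text \<open>Compare both expressions of the form at a vector that kills two terms: orthogonal to
  \<open>y1, u3\<close> for \<open>0 <= l2\<close>, to \<open>y3, u1\<close> for
  \<open>l2 <= g2\<close>, to \<open>y1, y2\<close> for \<open>g3 <= l3\<close>, and to
  \<open>u1, u2\<close> for \<open>l3 <= 0\<close>.\<close>

lemma rank_one_sum_spectrum_mixed:
  assumes "rank_one_sum_spectrum g1 g2 g3 l1 l2 l3" and l: "l2 \<le> l1" "l3 \<le> l2"
    and g: "0 \<le> g1" "0 \<le> g2" "g3 \<le> 0"
  shows "0 \<le> l2" "l2 \<le> g2" "g3 \<le> l3" "l3 \<le> 0"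
proof -
  obtain u1 u2 u3 y1 y2 y3 where un: "u1 \<in> unit3" "u2 \<in> unit3" "u3 \<in> unit3" "y1 \<in> unit3" "y2 \<in> unit3" "y3 \<in> unit3"
    and N': "\<forall>x\<in>carrier_vec 3. norm_sq x = (cmod (x \<bullet>c y1))\<^sup>2 + (cmod (x \<bullet>c y2))\<^sup>2 + (cmod (x \<bullet>c y3))\<^sup>2"
    and F': "\<forall>x\<in>carrier_vec 3. l1 * (cmod (x \<bullet>c y1))\<^sup>2 + l2 * (cmod (x \<bullet>c y2))\<^sup>2 + l3 * (cmod (x \<bullet>c y3))\<^sup>2
      = g1 * (cmod (x \<bullet>c u1))\<^sup>2 + g2 * (cmod (x \<bullet>c u2))\<^sup>2 + g3 * (cmod (x \<bullet>c u3))\<^sup>2"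
    by (rule rank_one_sum_spectrumE[OF assms(1)])
  note N = bspec[OF N'] and F = bspec[OF F']
  have car: "u \<in> carrier_vec 3" "norm_sq u = 1" if "u \<in> unit3" for u
    using that by (auto simp: unit3_def)
  show "0 \<le> l2"
  proof -
    obtain x where x: "x \<in> carrier_vec 3" "x \<bullet>c y1 = 0" "x \<bullet>c u3 = 0" "norm_sq x > 0"
      using perp_to_two car un by metis
    have "0 \<le> l2 * (cmod (x \<bullet>c y2))\<^sup>2 + l3 * (cmod (x \<bullet>c y3))\<^sup>2"
      using F[OF x(1)] x g by simp
    also have "\<dots> \<le> l2 * norm_sq x"
      using N[OF x(1)] x l by (simp add: distrib_left mult_right_mono)
    finally show ?thesis using x by (simp add: zero_le_mult_iff)
  qed
  show "l2 \<le> g2"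
  proof -
    obtain x where x: "x \<in> carrier_vec 3" "x \<bullet>c y3 = 0" "x \<bullet>c u1 = 0" "norm_sq x > 0"
      using perp_to_two car un by metis
    have "l2 * norm_sq x \<le> l1 * (cmod (x \<bullet>c y1))\<^sup>2 + l2 * (cmod (x \<bullet>c y2))\<^sup>2"
      using N[OF x(1)] x l by (simp add: distrib_left mult_right_mono)
    also have "\<dots> = g2 * (cmod (x \<bullet>c u2))\<^sup>2 + g3 * (cmod (x \<bullet>c u3))\<^sup>2"
      using F[OF x(1)] x by simp
    also have "\<dots> \<le> g2 * (cmod (x \<bullet>c u2))\<^sup>2"
      using g by (simp add: mult_nonpos_nonneg)
    also have "\<dots> \<le> g2 * norm_sq x" using cscalar_prod_unit_le[OF x(1) un(2)] g by (simp add: mult_left_mono)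
    finally show ?thesis using x by simp
  qed
  show "g3 \<le> l3"
  proof -
    obtain x where x: "x \<in> carrier_vec 3" "x \<bullet>c y1 = 0" "x \<bullet>c y2 = 0" "norm_sq x > 0"
      using perp_to_two car un by metis
    have "g3 * norm_sq x \<le> g3 * (cmod (x \<bullet>c u3))\<^sup>2"
      using cscalar_prod_unit_le[OF x(1) un(3)] g by (simp add: mult_left_mono_neg)
    also have "\<dots> \<le> g1 * (cmod (x \<bullet>c u1))\<^sup>2 + g2 * (cmod (x \<bullet>c u2))\<^sup>2 + g3 * (cmod (x \<bullet>c u3))\<^sup>2"
      using g by simp
    also have "\<dots> = l3 * norm_sq x" using F[OF x(1)] N[OF x(1)] x by simp
    finally show ?thesis using x by simp
  qed
  show "l3 \<le> 0"
  proof -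
    obtain x where x: "x \<in> carrier_vec 3" "x \<bullet>c u1 = 0" "x \<bullet>c u2 = 0" "norm_sq x > 0"
      using perp_to_two car un by metis
    have "l3 * norm_sq x \<le> l1 * (cmod (x \<bullet>c y1))\<^sup>2 + l2 * (cmod (x \<bullet>c y2))\<^sup>2 + l3 * (cmod (x \<bullet>c y3))\<^sup>2"
      using N[OF x(1)] l by (auto simp: distrib_left intro!: add_mono mult_right_mono)
    also have "\<dots> = g3 * (cmod (x \<bullet>c u3))\<^sup>2" using F[OF x(1)] x by simp
    also have "\<dots> \<le> 0" using g by (simp add: mult_nonpos_nonneg)
    finally show ?thesis using x by (simp add: mult_le_0_iff)
  qed
qed

text \<open>The case \<open>g2 > 0\<close> covers both patterns in which at most the last weight is
  negative; negation supplies the other two.\<close>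

lemma rank_one_sum_spectrum_weyl_region:
  assumes S: "rank_one_sum_spectrum g1 g2 g3 l1 l2 l3" and l: "l2 \<le> l1" "l3 \<le> l2"
    and g: "g2 \<le> g1" "g3 \<le> g2" "g1 \<noteq> 0" "g2 \<noteq> 0" "g3 \<noteq> 0"
  shows "weyl_region g1 g2 g3 l1 l2 l3"
proof -
  have pos: "weyl_region g1 g2 g3 l1 l2 l3"
    if "rank_one_sum_spectrum g1 g2 g3 l1 l2 l3" "l2 \<le> l1" "l3 \<le> l2" "g2 \<le> g1" "g3 \<le> g2" "g3 \<noteq> 0" "g2 > 0"
    for g1 g2 g3 l1 l2 l3
    using that rank_one_sum_spectrum_nonneg[OF that(1-3)] rank_one_sum_spectrum_mixed[OF that(1-3)]
      rank_one_sum_spectrum_trace[OF that(1)]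
    by (auto simp: weyl_region_def)
  show ?thesis
  proof (cases "g2 > 0")
    case False
    then have "weyl_region (- g3) (- g2) (- g1) (- l3) (- l2) (- l1)"
      using rank_one_sum_spectrum_uminus[OF S] l g by (intro pos) auto
    then show ?thesis using g by (simp add: weyl_region_uminus)
  qed (use pos S l g in blast)
qed

section \<open>Construction of matrices with prescribed spectrum\<close>

lemma nonneg_if_sum_one_prod_nonneg:
  fixes a b :: real
  assumes "a + b = 1" "0 \<le> a * b"
  shows "0 \<le> a" "0 \<le> b"
  using assms by (auto simp: zero_le_mult_iff)

text \<open>A real symmetric 2x2 matrix with trace \<open>1\<close> and determinant \<open>0\<close>
  is the projection onto a unit vector \<open>(c, d)\<close>; the sign of the off-diagonal entry
  \<open>m\<close> goes into \<open>d\<close>.\<close>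

lemma rank_one_2x2:
  fixes a b m :: real
  assumes "a + b = 1" "a * b = m\<^sup>2"
  obtains c d where "c\<^sup>2 = a" "d\<^sup>2 = b" "c * d = m"
proof -
  have ab: "a \<ge> 0" "b \<ge> 0" using nonneg_if_sum_one_prod_nonneg[of a b] assms by auto
  have m: "sqrt a * sqrt b = \<bar>m\<bar>" using assms(2) by (simp flip: real_sqrt_mult)
  show thesis
  proof (cases "m \<ge> 0")
    case True
    with m ab show thesis by (intro that[of "sqrt a" "sqrt b"]) auto
  next
    case False
    with m ab show thesis by (intro that[of "sqrt a" "- sqrt b"]) auto
  qed
qed

text \<open>\<open>p\<close> lies between \<open>0\<close> and \<open>q\<close>, whatever the sign of \<open>q\<close>.\<close>

definition between_0 :: "real \<Rightarrow> real \<Rightarrow> bool" where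
  "between_0 p q \<longleftrightarrow> 0 \<le> p * (q - p)"

lemma between_0_ratio:
  assumes "between_0 p q"
  obtains t where "0 \<le> t" "t \<le> 1" "p = t * q"
proof (cases "q = 0")
  case True
  then have "p * p \<le> 0" using assms by (simp add: between_0_def)
  then have "p = 0" by (auto simp: mult_le_0_iff)
  then show ?thesis using that[of 0] by simp
next
  case False
  have "p / q * (1 - p / q) = p * (q - p) / q\<^sup>2"
    using False by (simp add: field_simps power2_eq_square)
  then have "0 \<le> p / q * (1 - p / q)" using assms by (simp add: between_0_def)
  then have "0 \<le> p / q" "0 \<le> 1 - p / q"
    using nonneg_if_sum_one_prod_nonneg[of "p / q" "1 - p / q"] by auto
  then show ?thesis using that[of "p / q"] False by auto
qed

text \<open>The vector \<open>(a, b)\<close> is chosen such that \<open>diag(m1, m2) - g1 (a, b) (a, b)*\<close> is singular; having trace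
  \<open>g2\<close>, it is then \<open>g2\<close> times a rank one projection.\<close>

lemma diag_as_rank_one_sum:
  fixes g1 g2 m1 m2 :: real
  assumes g: "g1 \<noteq> 0" "g2 \<noteq> 0" and sum: "g1 + g2 = m1 + m2" and prod: "between_0 (m1 * m2) (g1 * g2)"
  obtains a b c d where "a\<^sup>2 + b\<^sup>2 = 1" "c\<^sup>2 + d\<^sup>2 = 1"
    "g1 * a\<^sup>2 + g2 * c\<^sup>2 = m1" "g1 * b\<^sup>2 + g2 * d\<^sup>2 = m2" "g1 * (a * b) + g2 * (c * d) = 0"
proof -
  have g2: "g2 = m1 + m2 - g1" using sum by simp
  have pq: "0 \<le> (m1 * m2) * (g1 * g2 - m1 * m2)" using prod by (simp add: between_0_def)
  \<comment> \<open>\<open>x\<close> stands for \<open>a^2\<close> and \<open>1 - x\<close> for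
    \<open>b^2\<close>; the equation says that the determinant of
    \<open>diag(m1, m2) - g1 (a, b) (a, b)*\<close> vanishes.\<close>
  obtain x where x: "0 \<le> x" "0 \<le> 1 - x" "g1 * (m1 * (1 - x) + m2 * x) = m1 * m2"
  proof (cases "m1 = m2")
    case True
    \<comment> \<open>For \<open>m1 = m2\<close> the equation no longer involves \<open>x\<close>;
      the condition on the product forces it to hold, through \<open>m2 = 0\<close> or
      \<open>g1 = m2\<close>.\<close>
    have "0 \<le> (m2 * m2) * (- ((g1 - m2)\<^sup>2))"
      using pq unfolding g2 True by (simp add: power2_eq_square algebra_simps)
    then have "m2 = 0 \<or> g1 = m2" by (auto simp: zero_le_mult_iff mult_le_0_iff)
    then show ?thesis using True that[of 1] by auto
  next
    case False
    \<comment> \<open>The linear equation solved for \<open>x\<close>. The numerator of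
      \<open>x * (1 - x)\<close> is exactly the product that \<open>prod\<close> makes nonnegative,
      which puts \<open>x\<close> between \<open>0\<close> and \<open>1\<close>.\<close>
    define x where "x = m1 * (m2 - g1) / (g1 * (m2 - m1))"
    have x1: "1 - x = m2 * (g1 - m1) / (g1 * (m2 - m1))"
      using False g by (simp add: x_def field_simps)
    have "x * (1 - x) = (m1 * m2) * (g1 * g2 - m1 * m2) / (g1 * (m2 - m1))\<^sup>2"
      unfolding x1 unfolding x_def g2 by (simp add: power2_eq_square algebra_simps)
    then have "0 \<le> x * (1 - x)" using pq by simp
    then have "0 \<le> x" "0 \<le> 1 - x" using nonneg_if_sum_one_prod_nonneg[of x "1 - x"] by auto
    moreover have "g1 * (m1 * (1 - x) + m2 * x) = m1 * m2"
    proof -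
      have e: "x * (g1 * (m2 - m1)) = m1 * (m2 - g1)" using False g by (simp add: x_def)
      have "g1 * (m1 * (1 - x) + m2 * x) = g1 * m1 + x * (g1 * (m2 - m1))" by (simp add: algebra_simps)
      also have "\<dots> = m1 * m2" unfolding e by (simp add: algebra_simps)
      finally show ?thesis .
    qed
    ultimately show ?thesis using that by blast
  qed
  obtain a b where a: "a\<^sup>2 = x" and b: "b\<^sup>2 = 1 - x" using x by (metis real_sqrt_pow2)
  \<comment> \<open>The remainder divided by \<open>g2\<close> has trace \<open>1\<close> and
    determinant \<open>0\<close>, hence is a projection.\<close>
  have "m1 - g1 * x + (m2 - g1 * (1 - x)) = g2" by (simp add: g2 algebra_simps)
  then have "((m1 - g1 * x) + (m2 - g1 * (1 - x))) / g2 = 1" using g by simp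
  then have s: "(m1 - g1 * x) / g2 + (m2 - g1 * (1 - x)) / g2 = 1" by (simp only: add_divide_distrib)
  moreover have "(m1 - g1 * x) / g2 * ((m2 - g1 * (1 - x)) / g2) = (- g1 * (a * b) / g2)\<^sup>2"
  proof -
    have "(m1 - g1 * x) * (m2 - g1 * (1 - x)) = (- g1 * (a * b))\<^sup>2"
    proof -
      have "(m1 - g1 * x) * (m2 - g1 * (1 - x)) = m1 * m2 - g1 * (m1 * (1 - x) + m2 * x) + g1\<^sup>2 * (x * (1 - x))"
        by (simp add: power2_eq_square algebra_simps)
      also have "\<dots> = (- g1 * (a * b))\<^sup>2"
        unfolding x(3) by (simp add: power_mult_distrib a b)
      finally show ?thesis .
    qed
    then show ?thesis by (simp add: power_divide power2_eq_square)
  qed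
  ultimately obtain c d where cd: "c\<^sup>2 = (m1 - g1 * x) / g2" "d\<^sup>2 = (m2 - g1 * (1 - x)) / g2"
    "c * d = - g1 * (a * b) / g2" using rank_one_2x2 by blast
  show thesis
  proof (rule that[of a b c d])
    show "c\<^sup>2 + d\<^sup>2 = 1" using s by (simp only: cd)
  qed (use g a b cd in auto)
qed

section \<open>Spectra of real symmetric 3x3 matrices\<close>

lemma lessThan_2: "{..<2::nat} = {0, 1}" by auto

lemma det_2x2:
  fixes A :: "'a :: comm_ring_1 mat"
  assumes "A \<in> carrier_mat 2 2"
  shows "det A = A $$ (0, 0) * A $$ (1, 1) - A $$ (0, 1) * A $$ (1, 0)"
proof -
  have "det A = (\<Sum>i<2. A $$ (i, 0) * cofactor A i 0)"
    using assms by (intro laplace_expansion_column) auto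
  also have "\<dots> = A $$ (0, 0) * A $$ (1, 1) - A $$ (0, 1) * A $$ (1, 0)"
    using assms by (simp add: lessThan_2 cofactor_def mat_delete_def det_single)
  finally show ?thesis .
qed

lemma det_3x3:
  fixes A :: "'a :: comm_ring_1 mat"
  assumes "A \<in> carrier_mat 3 3"
  shows "det A = A $$ (0, 0) * (A $$ (1, 1) * A $$ (2, 2) - A $$ (1, 2) * A $$ (2, 1))
    - A $$ (1, 0) * (A $$ (0, 1) * A $$ (2, 2) - A $$ (0, 2) * A $$ (2, 1))
    + A $$ (2, 0) * (A $$ (0, 1) * A $$ (1, 2) - A $$ (0, 2) * A $$ (1, 1))"
proof -
  have "det A = (\<Sum>i<3. A $$ (i, 0) * cofactor A i 0)"
    using assms by (intro laplace_expansion_column) auto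
  also have "\<dots> = A $$ (0, 0) * (A $$ (1, 1) * A $$ (2, 2) - A $$ (1, 2) * A $$ (2, 1))
    - A $$ (1, 0) * (A $$ (0, 1) * A $$ (2, 2) - A $$ (0, 2) * A $$ (2, 1))
    + A $$ (2, 0) * (A $$ (0, 1) * A $$ (1, 2) - A $$ (0, 2) * A $$ (1, 1))"
    using assms by (simp add: lessThan_3 cofactor_def mat_delete_def det_2x2 numeral_2_eq_2) (simp add: algebra_simps)
  finally show ?thesis .
qed

text \<open>Vieta: trace, sum of the principal 2x2 minors and determinant are matched with the
  elementary symmetric functions of \<open>x, y, z\<close>. The diagonal is \<open>a, b, c\<close>;
  \<open>d\<close>, \<open>e\<close>, \<open>f\<close> are the entries at \<open>(0, 1)\<close>,
  \<open>(0, 2)\<close>, \<open>(1, 2)\<close>.\<close>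

lemma symmetric_3x3_char_poly_factor:
  fixes t a b c d e f x y z :: "'a :: comm_ring_1"
  assumes tr: "a + b + c = x + y + z"
    and e2: "a * b - d\<^sup>2 + a * c - e\<^sup>2 + b * c - f\<^sup>2 = x * y + x * z + y * z"
    and det: "a * b * c + 2 * d * f * e - a * f\<^sup>2 - b * e\<^sup>2 - c * d\<^sup>2 = x * y * z"
  shows "(t - a) * ((t - b) * (t - c) - f\<^sup>2) - d * (d * (t - c) + e * f) - e * (d * f + e * (t - b))
    = (t - x) * (t - y) * (t - z)"
proof -
  have "(t - a) * ((t - b) * (t - c) - f\<^sup>2) - d * (d * (t - c) + e * f) - e * (d * f + e * (t - b))
    = t ^ 3 - (a + b + c) * t\<^sup>2 + (a * b - d\<^sup>2 + a * c - e\<^sup>2 + b * c - f\<^sup>2) * t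
      - (a * b * c + 2 * d * f * e - a * f\<^sup>2 - b * e\<^sup>2 - c * d\<^sup>2)"
    by (simp add: power2_eq_square power3_eq_cube algebra_simps)
  also have "\<dots> = (t - x) * (t - y) * (t - z)"
    unfolding tr e2 det by (simp add: power2_eq_square power3_eq_cube algebra_simps)
  finally show ?thesis .
qed

text \<open>Three coefficients of the characteristic polynomial identify the spectrum with
  multiplicities, without any eigenvector having to be exhibited.\<close>

lemma symmetric_real_3x3_eigvals:
  fixes f :: "nat \<Rightarrow> nat \<Rightarrow> real"
  assumes sym: "f 1 0 = f 0 1" "f 2 0 = f 0 2" "f 2 1 = f 1 2"
    and tr: "f 0 0 + f 1 1 + f 2 2 = x + y + z"
    and e2: "f 0 0 * f 1 1 - (f 0 1)\<^sup>2 + f 0 0 * f 2 2 - (f 0 2)\<^sup>2 + f 1 1 * f 2 2 - (f 1 2)\<^sup>2 = x * y + x * z + y * z"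
    and det: "f 0 0 * f 1 1 * f 2 2 + 2 * f 0 1 * f 1 2 * f 0 2 - f 0 0 * (f 1 2)\<^sup>2 - f 1 1 * (f 0 2)\<^sup>2 - f 2 2 * (f 0 1)\<^sup>2 = x * y * z"
  shows "hermitian3_with_eigvals (mat 3 3 (\<lambda>(i, j). complex_of_real (f i j))) x y z"
proof -
  let ?M = "mat 3 3 (\<lambda>(i, j). complex_of_real (f i j))"
  have "char_poly ?M = [:- of_real x, 1:] * [:- of_real y, 1:] * [:- of_real z, 1:]"
  proof -
    \<comment> \<open>The polynomials are compared through their values, which turns the claim into
      an identity of complex numbers.\<close>
    have "poly (char_poly ?M) t = poly ([:- of_real x, 1:] * [:- of_real y, 1:] * [:- of_real z, 1:]) t" for t
    proof -
      have c: "of_real (f 0 0) + of_real (f 1 1) + of_real (f 2 2) = (of_real x + of_real y + of_real z :: complex)"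
        "of_real (f 0 0) * of_real (f 1 1) - (of_real (f 0 1))\<^sup>2 + of_real (f 0 0) * of_real (f 2 2) - (of_real (f 0 2))\<^sup>2
          + of_real (f 1 1) * of_real (f 2 2) - (of_real (f 1 2))\<^sup>2
          = (of_real x * of_real y + of_real x * of_real z + of_real y * of_real z :: complex)"
        "of_real (f 0 0) * of_real (f 1 1) * of_real (f 2 2) + 2 * of_real (f 0 1) * of_real (f 1 2) * of_real (f 0 2)
          - of_real (f 0 0) * (of_real (f 1 2))\<^sup>2 - of_real (f 1 1) * (of_real (f 0 2))\<^sup>2 - of_real (f 2 2) * (of_real (f 0 1))\<^sup>2
          = (of_real x * of_real y * of_real z :: complex)"
        using arg_cong[OF tr, of complex_of_real] arg_cong[OF e2, of complex_of_real] arg_cong[OF det, of complex_of_real]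
        by simp_all
      have "poly (char_poly ?M) t = (t - of_real (f 0 0)) * ((t - of_real (f 1 1)) * (t - of_real (f 2 2)) - (of_real (f 1 2))\<^sup>2)
        - of_real (f 0 1) * (of_real (f 0 1) * (t - of_real (f 2 2)) + of_real (f 0 2) * of_real (f 1 2))
        - of_real (f 0 2) * (of_real (f 0 1) * of_real (f 1 2) + of_real (f 0 2) * (t - of_real (f 1 1)))"
      proof -
        have "char_poly_matrix ?M = mat 3 3 (\<lambda>(i, j). if i = j then [:- of_real (f i j), 1:] else [:- of_real (f i j):])"
          by (rule eq_matI) (auto simp: char_poly_matrix_def)
        then show ?thesis
          unfolding char_poly_def using sym by (simp add: det_3x3) (simp add: power2_eq_square algebra_simps)
      qed
      also have "\<dots> = (t - of_real x) * (t - of_real y) * (t - of_real z)"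
        using c by (rule symmetric_3x3_char_poly_factor)
      finally show ?thesis by (simp add: algebra_simps)
    qed
    then have "poly (char_poly ?M) = poly ([:- of_real x, 1:] * [:- of_real y, 1:] * [:- of_real z, 1:])"
      by (rule ext)
    then show ?thesis by (simp only: poly_eq_poly_eq_iff)
  qed
  then have "eigvals ?M = triple x y z"
    by (simp add: eigvals_def proots_mult triple_def del: mult_pCons_left mult_pCons_right)
  moreover have "hermitian ?M"
    unfolding hermitian_def
  proof (rule eq_matI)
    fix i j assume "i < dim_row ?M" "j < dim_col ?M"
    then have ij: "i \<in> {0, 1, 2}" "j \<in> {0, 1, 2}" by auto
    then have "f j i = f i j" using sym by auto
    then show "mat_adjoint ?M $$ (i, j) = ?M $$ (i, j)"
      using ij by (auto simp: mat_adjoint_def mat_of_rows_def)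
  qed (auto simp: mat_adjoint_def)
  ultimately show ?thesis by (simp add: hermitian3_with_eigvals_def)
qed

text \<open>The matrix \<open>l - 3 l u u*\<close> for a real vector \<open>u\<close>; real vectors
  suffice to realize every point of the polytope.\<close>

definition rank_one_mat :: "real \<Rightarrow> real \<times> real \<times> real \<Rightarrow> complex mat" where
  "rank_one_mat l u = (case u of (a, b, c) \<Rightarrow> mat 3 3 (\<lambda>(i, j). complex_of_real
    ((if i = j then l else 0) - 3 * l * ([a, b, c] ! i * [a, b, c] ! j))))"

lemma rank_one_mat_eigvals:
  assumes "a\<^sup>2 + b\<^sup>2 + c\<^sup>2 = 1"
  shows "hermitian3_with_eigvals (rank_one_mat l (a, b, c)) l l (- 2 * l)"
  unfolding rank_one_mat_def prod.case
proof (rule symmetric_real_3x3_eigvals)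
  let ?f = "\<lambda>i j. (if i = j then l else 0) - 3 * l * ([a, b, c] ! i * [a, b, c] ! j)"
  have "?f 0 0 + ?f 1 1 + ?f 2 2 = 3 * l - 3 * l * (a\<^sup>2 + b\<^sup>2 + c\<^sup>2)"
    by (simp add: power2_eq_square algebra_simps)
  then show "?f 0 0 + ?f 1 1 + ?f 2 2 = l + l + - 2 * l" using assms by simp
  have "?f 0 0 * ?f 1 1 - (?f 0 1)\<^sup>2 + ?f 0 0 * ?f 2 2 - (?f 0 2)\<^sup>2 + ?f 1 1 * ?f 2 2 - (?f 1 2)\<^sup>2
    = 3 * l\<^sup>2 - 6 * l\<^sup>2 * (a\<^sup>2 + b\<^sup>2 + c\<^sup>2)"
    by (simp add: power2_eq_square algebra_simps)
  then show "?f 0 0 * ?f 1 1 - (?f 0 1)\<^sup>2 + ?f 0 0 * ?f 2 2 - (?f 0 2)\<^sup>2 + ?f 1 1 * ?f 2 2 - (?f 1 2)\<^sup>2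
    = l * l + l * (- 2 * l) + l * (- 2 * l)"
    using assms by (simp add: power2_eq_square)
  have "?f 0 0 * ?f 1 1 * ?f 2 2 + 2 * ?f 0 1 * ?f 1 2 * ?f 0 2 - ?f 0 0 * (?f 1 2)\<^sup>2 - ?f 1 1 * (?f 0 2)\<^sup>2
    - ?f 2 2 * (?f 0 1)\<^sup>2 = l\<^sup>2 * (l - 3 * l * (a\<^sup>2 + b\<^sup>2 + c\<^sup>2))"
    by (simp add: power2_eq_square algebra_simps)
  then show "?f 0 0 * ?f 1 1 * ?f 2 2 + 2 * ?f 0 1 * ?f 1 2 * ?f 0 2 - ?f 0 0 * (?f 1 2)\<^sup>2 - ?f 1 1 * (?f 0 2)\<^sup>2
    - ?f 2 2 * (?f 0 1)\<^sup>2 = l * l * (- 2 * l)"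
    using assms by (simp add: power2_eq_square)
qed simp_all

text \<open>The first two summands add up to a matrix with eigenvalues \<open>m, k3, 0\<close>; the third one, taken
  orthogonal to the eigenvector of \<open>k3\<close>, moves \<open>m, 0\<close> to \<open>k1, k2\<close>.\<close>

definition rank_one_chain :: "real \<Rightarrow> real \<Rightarrow> real \<Rightarrow> real \<Rightarrow> real \<Rightarrow> real \<Rightarrow> bool" where
  "rank_one_chain g1 g2 g3 k1 k2 k3 \<longleftrightarrow> (\<exists>m. g1 + g2 = m + k3 \<and> between_0 (m * k3) (g1 * g2) \<and>
    m + g3 = k1 + k2 \<and> between_0 (k1 * k2) (m * g3))"

lemma rank_one_chain_uminus:
  assumes "rank_one_chain (- g1) (- g2) (- g3) (- k1) (- k2) (- k3)"
  shows "rank_one_chain g1 g2 g3 k1 k2 k3"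
proof -
  obtain m where "- g1 + - g2 = m + - k3" "between_0 (m * - k3) (- g1 * - g2)"
    "m + - g3 = - k1 + - k2" "between_0 (- k1 * - k2) (m * - g3)"
    using assms by (auto simp: rank_one_chain_def)
  then show ?thesis
    unfolding rank_one_chain_def by (intro exI[of _ "- m"]) auto
qed

text \<open>Freezing \<open>k3\<close> forces \<open>m = g1 + g2 - k3 = k1 + k2 - g3\<close>, and
  then \<open>g1 g2 - m k3 = (g1 - k3) (g2 - k3)\<close> and
  \<open>m g3 - k1 k2 = (k1 - g3) (g3 - k2)\<close>. Both determinant conditions thus become sign
  checks. The reversed chain in the conclusion comes from negation, which exchanges
  \<open>g1\<close> and \<open>g3\<close>.\<close>

lemma weyl_region_imp_chain:
  assumes R: "weyl_region g1 g2 g3 l1 l2 l3"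
    and g: "g2 \<le> g1" "g3 \<le> g2" "g1 \<noteq> 0" "g2 \<noteq> 0" "g3 \<noteq> 0"
  obtains k1 k2 k3 where "mset [k1, k2, k3] = mset [l1, l2, l3]"
    "rank_one_chain g1 g2 g3 k1 k2 k3 \<or> rank_one_chain g3 g2 g1 k1 k2 k3"
proof -
  have pos: "\<exists>k1 k2 k3. mset [k1, k2, k3] = mset [l1, l2, l3] \<and> rank_one_chain g1 g2 g3 k1 k2 k3"
    if R: "weyl_region g1 g2 g3 l1 l2 l3" and g: "g2 \<le> g1" "g3 \<le> g2" "0 < g2" "g3 \<noteq> 0" for g1 g2 g3 l1 l2 l3
  proof -
    have s: "l1 + l2 + l3 = g1 + g2 + g3" "l2 \<le> l1" "l3 \<le> l2" using R by (auto simp: weyl_region_def)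
    \<comment> \<open>By the trace, the first two alternatives are \<open>l2 <= g3\<close> and
      \<open>l2 > g3\<close>. For \<open>g3 > 0\<close> the two moving eigenvalues have to enclose
      \<open>g3\<close>, so \<open>l3\<close> is frozen in the first and \<open>l1\<close> in the
      second; for \<open>g3 < 0\<close> it is \<open>l2\<close>.\<close>
    consider "g3 > 0" "l3 \<ge> g1 + g2 - l1" | "g3 > 0" "l3 < g1 + g2 - l1" | "g3 < 0"
      using g by linarith
    then show ?thesis
    proof cases
      case 1
      have r: "g1 \<le> l1" "0 \<le> l3" "l3 \<le> g3" using R 1 by (auto simp: weyl_region_def)
      define m where "m = g1 + g2 - l3"
      have m: "m = l1 + l2 - g3" using s by (simp add: m_def)
      have "0 \<le> (m * l3) * ((g1 - l3) * (g2 - l3))"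
        using r g by (simp add: m_def)
      also have "(g1 - l3) * (g2 - l3) = g1 * g2 - m * l3" by (simp add: m_def algebra_simps)
      finally have b1: "between_0 (m * l3) (g1 * g2)" by (simp add: between_0_def)
      have "0 \<le> (l1 * l2) * ((l1 - g3) * (g3 - l2))"
        using r g s 1 by simp
      also have "(l1 - g3) * (g3 - l2) = m * g3 - l1 * l2" by (simp add: m algebra_simps)
      finally have "between_0 (l1 * l2) (m * g3)" by (simp add: between_0_def)
      with b1 m have "rank_one_chain g1 g2 g3 l1 l2 l3"
        unfolding rank_one_chain_def by (intro exI[of _ m]) (auto simp: m_def)
      then show ?thesis by blast
    next
      case 2
      have r: "g1 \<le> l1" "0 \<le> l3" "l3 \<le> g3" using R 2 by (auto simp: weyl_region_def)
      define m where "m = g1 + g2 - l1"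
      have m: "m = l2 + l3 - g3" using s by (simp add: m_def)
      have "0 \<le> (m * l1) * ((l1 - g1) * (l1 - g2))"
        using r g 2 by (simp add: m_def)
      also have "(l1 - g1) * (l1 - g2) = g1 * g2 - m * l1" by (simp add: m_def algebra_simps)
      finally have b1: "between_0 (m * l1) (g1 * g2)" by (simp add: between_0_def)
      have "0 \<le> (l2 * l3) * ((l2 - g3) * (g3 - l3))"
        using r g s 2 by simp
      also have "(l2 - g3) * (g3 - l3) = m * g3 - l2 * l3" by (simp add: m algebra_simps)
      finally have "between_0 (l2 * l3) (m * g3)" by (simp add: between_0_def)
      with b1 m have "rank_one_chain g1 g2 g3 l2 l3 l1"
        unfolding rank_one_chain_def by (intro exI[of _ m]) (auto simp: m_def)
      moreover have "mset [l2, l3, l1] = mset [l1, l2, l3]" by simp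
      ultimately show ?thesis by blast
    next
      case 3
      have r: "0 \<le> l2" "l2 \<le> g2" "g3 \<le> l3" "l3 \<le> 0" using R 3 g by (auto simp: weyl_region_def)
      define m where "m = g1 + g2 - l2"
      have m: "m = l1 + l3 - g3" using s by (simp add: m_def)
      have "0 \<le> (m * l2) * ((g1 - l2) * (g2 - l2))"
        using r g by (simp add: m_def)
      also have "(g1 - l2) * (g2 - l2) = g1 * g2 - m * l2" by (simp add: m_def algebra_simps)
      finally have b1: "between_0 (m * l2) (g1 * g2)" by (simp add: between_0_def)
      have "0 \<le> (l1 * - l3) * ((l1 - g3) * (l3 - g3))"
        using r g s 3 by (intro mult_nonneg_nonneg) auto
      also have "\<dots> = (l1 * l3) * (m * g3 - l1 * l3)" by (simp add: m algebra_simps)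
      finally have "between_0 (l1 * l3) (m * g3)" by (simp add: between_0_def)
      with b1 m have "rank_one_chain g1 g2 g3 l1 l3 l2"
        unfolding rank_one_chain_def by (intro exI[of _ m]) (auto simp: m_def)
      moreover have "mset [l1, l3, l2] = mset [l1, l2, l3]" by simp
      ultimately show ?thesis by blast
    qed
  qed
  show thesis
  proof (cases "g2 > 0")
    case True
    then show thesis using pos[OF R] g that by blast
  next
    case False
    have "weyl_region (- g3) (- g2) (- g1) (- l3) (- l2) (- l1)"
      using R weyl_region_uminus[OF g(3-5) g(1,2)] by blast
    moreover have "- g2 \<le> - g3" "- g1 \<le> - g2" "0 < - g2" "- g1 \<noteq> 0" using g False by auto
    ultimately obtain k1 k2 k3 where k: "mset [k1, k2, k3] = mset [- l3, - l2, - l1]"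
      "rank_one_chain (- g3) (- g2) (- g1) k1 k2 k3"
      using pos by blast
    have "mset (map uminus [k1, k2, k3]) = mset (map uminus [- l3, - l2, - l1])"
      using k(1) unfolding mset_map by (rule arg_cong)
    then have "mset [- k1, - k2, - k3] = mset [l3, l2, l1]" by (simp only: list.map minus_minus)
    also have "\<dots> = mset [l1, l2, l3]" by simp
    finally have "mset [- k1, - k2, - k3] = mset [l1, l2, l3]" .
    moreover have "rank_one_chain g3 g2 g1 (- k1) (- k2) (- k3)"
      by (rule rank_one_chain_uminus) (simp only: minus_minus k(2))
    ultimately show thesis using that by blast
  qed
qed

text \<open>Two vectors in the plane of the first two axes produce \<open>diag(m, k3, 0)\<close>;
  the third lies in the plane of the first and last axis and so leaves \<open>k3\<close> alone. The
  value \<open>lC = 0\<close> is permitted, which serves the sum of two matrices.\<close>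

lemma rank_one_mats_with_spectrum:
  assumes l: "lA \<noteq> 0" "lB \<noteq> 0"
    and chain: "rank_one_chain (- 3 * lA) (- 3 * lB) (- 3 * lC) k1 k2 k3"
  obtains u v w where "hermitian3_with_eigvals (rank_one_mat lA u) lA lA (- 2 * lA)"
    "hermitian3_with_eigvals (rank_one_mat lB v) lB lB (- 2 * lB)"
    "hermitian3_with_eigvals (rank_one_mat lC w) lC lC (- 2 * lC)"
    "eigvals (rank_one_mat lA u + rank_one_mat lB v + rank_one_mat lC w) =
      triple (k1 + (lA + lB + lC)) (k2 + (lA + lB + lC)) (k3 + (lA + lB + lC))"
proof -
  define g1 g2 g3 where g_def: "g1 = - 3 * lA" "g2 = - 3 * lB" "g3 = - 3 * lC"
  obtain m where m: "g1 + g2 = m + k3" "between_0 (m * k3) (g1 * g2)"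
    "m + g3 = k1 + k2" "between_0 (k1 * k2) (m * g3)"
    using chain by (auto simp: rank_one_chain_def g_def)
  have g0: "g1 \<noteq> 0" "g2 \<noteq> 0" using l by (simp_all add: g_def)
  obtain a b c d where abcd: "a\<^sup>2 + b\<^sup>2 = 1" "c\<^sup>2 + d\<^sup>2 = 1"
    "g1 * a\<^sup>2 + g2 * c\<^sup>2 = m" "g1 * b\<^sup>2 + g2 * d\<^sup>2 = k3" "g1 * (a * b) + g2 * (c * d) = 0"
    by (rule diag_as_rank_one_sum[OF g0 m(1,2)])
  \<comment> \<open>With the third vector \<open>(p, 0, q)\<close>, the moving 2x2 block has
    determinant \<open>m g3 q^2\<close>; so the ratio \<open>t\<close> becomes
    \<open>q^2\<close>.\<close>
  obtain t where t: "0 \<le> t" "t \<le> 1" "k1 * k2 = t * (m * g3)" using between_0_ratio[OF m(4)] by blast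
  define p q where "p = sqrt (1 - t)" and "q = sqrt t"
  have q2: "q\<^sup>2 = t" using t(1) by (simp add: q_def)
  have "p\<^sup>2 = 1 - t" using t(2) by (simp add: p_def)
  then have pq: "p\<^sup>2 + q\<^sup>2 = 1" "k1 * k2 = q\<^sup>2 * (m * g3)" unfolding q2 t(3) by simp_all
  let ?A = "rank_one_mat lA (a, b, 0)" and ?B = "rank_one_mat lB (c, d, 0)" and ?C = "rank_one_mat lC (p, 0, q)"
  have A: "hermitian3_with_eigvals ?A lA lA (- 2 * lA)" and B: "hermitian3_with_eigvals ?B lB lB (- 2 * lB)"
    and C: "hermitian3_with_eigvals ?C lC lC (- 2 * lC)"
    by (rule rank_one_mat_eigvals, use abcd(1,2) pq(1) in simp)+
  define L where "L = lA + lB + lC"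
  \<comment> \<open>Up to the shift by \<open>L\<close>, this is
    \<open>diag(m, k3, 0) + g3 (p, 0, q) (p, 0, q)*\<close>, whose middle row and column
    decouple.\<close>
  define f where "f i j = (if i = j then L else 0) +
    [[m + g3 * p\<^sup>2, 0, g3 * (p * q)], [0, k3, 0], [g3 * (p * q), 0, g3 * q\<^sup>2]] ! i ! j" for i j :: nat
  have sum: "?A + ?B + ?C = mat 3 3 (\<lambda>(i, j). complex_of_real (f i j))"
  proof (rule eq_matI)
    fix i j assume "i < dim_row (mat 3 3 (\<lambda>(i, j). complex_of_real (f i j)))"
      "j < dim_col (mat 3 3 (\<lambda>(i, j). complex_of_real (f i j)))"
    then have ij: "i < 3" "j < 3" "i \<in> {0, 1, 2}" "j \<in> {0, 1, 2}" by auto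
    define e where "e xs l = (if i = j then l else 0) - 3 * l * (xs ! i * xs ! j)"
      for xs :: "real list" and l :: real
    have "e [a, b, 0] lA + e [c, d, 0] lB + e [p, 0, q] lC =
      (if i = j then L else 0) + (g1 * ([a, b, 0] ! i * [a, b, 0] ! j) + g2 * ([c, d, 0] ! i * [c, d, 0] ! j))
        + g3 * ([p, 0, q] ! i * [p, 0, q] ! j)"
      by (simp add: e_def L_def g_def)
    also have "g1 * ([a, b, 0] ! i * [a, b, 0] ! j) + g2 * ([c, d, 0] ! i * [c, d, 0] ! j)
      = [[m, 0, 0], [0, k3, 0], [0, 0, 0]] ! i ! j"
      using ij(3,4) abcd(3-5) by (auto simp: power2_eq_square mult.commute)
    also have "(if i = j then L else 0) + [[m, 0, 0], [0, k3, 0], [0, 0, 0]] ! i ! j + g3 * ([p, 0, q] ! i * [p, 0, q] ! j) = f i j"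
      using ij(3,4) by (auto simp: f_def power2_eq_square)
    finally have "e [a, b, 0] lA + e [c, d, 0] lB + e [p, 0, q] lC = f i j" .
    moreover have "(?A + ?B + ?C) $$ (i, j) = of_real (e [a, b, 0] lA + e [c, d, 0] lB + e [p, 0, q] lC)"
      using ij(1,2) by (simp add: rank_one_mat_def e_def)
    ultimately show "(?A + ?B + ?C) $$ (i, j) = mat 3 3 (\<lambda>(i, j). complex_of_real (f i j)) $$ (i, j)"
      using ij(1,2) by simp
  qed (auto simp: rank_one_mat_def)
  have "hermitian3_with_eigvals (mat 3 3 (\<lambda>(i, j). complex_of_real (f i j))) (k1 + L) (k2 + L) (k3 + L)"
  proof (rule symmetric_real_3x3_eigvals)
    have f: "f 0 0 = m + g3 * p\<^sup>2 + L" "f 1 1 = k3 + L" "f 2 2 = g3 * q\<^sup>2 + L" "f 0 1 = 0" "f 1 2 = 0"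
      "f 0 2 = g3 * (p * q)" "f 1 0 = 0" "f 2 1 = 0" "f 2 0 = g3 * (p * q)"
      by (simp_all add: f_def)
    show "f 1 0 = f 0 1" "f 2 0 = f 0 2" "f 2 1 = f 1 2" by (simp_all only: f)
    have "m + g3 * p\<^sup>2 + L + (g3 * q\<^sup>2 + L) = m + g3 * (p\<^sup>2 + q\<^sup>2) + 2 * L"
      by (simp add: algebra_simps)
    then have T: "f 0 0 + f 2 2 = k1 + L + (k2 + L)"
      unfolding f using pq m(3) by simp
    have "(m + g3 * p\<^sup>2 + L) * (g3 * q\<^sup>2 + L) - (g3 * (p * q))\<^sup>2
      = q\<^sup>2 * (m * g3) + L * (m + g3 * (p\<^sup>2 + q\<^sup>2)) + L * L"
      by (simp add: power2_eq_square algebra_simps)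
    also have "\<dots> = k1 * k2 + L * (k1 + k2) + L * L" using pq m(3) by simp
    finally have D: "f 0 0 * f 2 2 - (f 0 2)\<^sup>2 = (k1 + L) * (k2 + L)"
      unfolding f by (simp add: algebra_simps)
    show "f 0 0 + f 1 1 + f 2 2 = k1 + L + (k2 + L) + (k3 + L)"
      using T f(2) by linarith
    have "f 0 0 * f 1 1 - (f 0 1)\<^sup>2 + f 0 0 * f 2 2 - (f 0 2)\<^sup>2 + f 1 1 * f 2 2 - (f 1 2)\<^sup>2
      = (f 0 0 + f 2 2) * f 1 1 + (f 0 0 * f 2 2 - (f 0 2)\<^sup>2)"
      unfolding f(4,5) by (simp add: algebra_simps)
    then show "f 0 0 * f 1 1 - (f 0 1)\<^sup>2 + f 0 0 * f 2 2 - (f 0 2)\<^sup>2 + f 1 1 * f 2 2 - (f 1 2)\<^sup>2 =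
      (k1 + L) * (k2 + L) + (k1 + L) * (k3 + L) + (k2 + L) * (k3 + L)"
      unfolding T D f(2) by (simp add: algebra_simps)
    have "f 0 0 * f 1 1 * f 2 2 + 2 * f 0 1 * f 1 2 * f 0 2 - f 0 0 * (f 1 2)\<^sup>2 - f 1 1 * (f 0 2)\<^sup>2
      - f 2 2 * (f 0 1)\<^sup>2 = (f 0 0 * f 2 2 - (f 0 2)\<^sup>2) * f 1 1"
      unfolding f(4,5) by (simp add: algebra_simps)
    then show "f 0 0 * f 1 1 * f 2 2 + 2 * f 0 1 * f 1 2 * f 0 2 - f 0 0 * (f 1 2)\<^sup>2 - f 1 1 * (f 0 2)\<^sup>2
      - f 2 2 * (f 0 1)\<^sup>2 = (k1 + L) * (k2 + L) * (k3 + L)"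
      unfolding D f(2) by simp
  qed
  then have "eigvals (?A + ?B + ?C) = triple (k1 + L) (k2 + L) (k3 + L)"
    by (simp add: sum hermitian3_with_eigvals_def)
  with A B C that show thesis unfolding L_def by blast
qed

section \<open>The main theorem\<close>

text \<open>Adjacent transpositions reach every order, so a property stable under them may be proved
  for sorted weights only.\<close>

lemma sorted_triple_cases:
  fixes x y z :: real
  assumes "\<And>a b c. b \<le> a \<Longrightarrow> c \<le> b \<Longrightarrow> P a b c"
    and "\<And>a b c. P a b c \<Longrightarrow> P b a c" "\<And>a b c. P a b c \<Longrightarrow> P a c b"
  shows "P x y z"
proof -
  consider "y \<le> x" "z \<le> y" | "z \<le> x" "y \<le> z" | "x \<le> y" "z \<le> x" | "z \<le> y" "x \<le> z" | "x \<le> z" "y \<le> x" | "y \<le> z" "x \<le> y"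
    by linarith
  then show ?thesis
  proof cases
    case 1 then show ?thesis by (rule assms(1))
  next
    case 2 then show ?thesis by (intro assms(3)[OF assms(1)])
  next
    case 3 then show ?thesis by (intro assms(2)[OF assms(1)])
  next
    case 4 then show ?thesis by (intro assms(2)[OF assms(3)[OF assms(1)]])
  next
    case 5 then show ?thesis by (intro assms(3)[OF assms(2)[OF assms(1)]])
  next
    case 6 then show ?thesis by (intro assms(2)[OF assms(3)[OF assms(2)[OF assms(1)]]])
  qed
qed

text \<open>Each summand is a multiple of the identity plus a rank one term of weight
  \<open>- 3\<close> times its parameter; subtracting the total multiple from the eigenvalues leaves
  the rank one terms.\<close>

lemma hermitian3_sum_spectrum:
  assumes A: "hermitian3_with_eigvals A lA lA (- 2 * lA)" and B: "hermitian3_with_eigvals B lB lB (- 2 * lB)"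
    and C: "hermitian3_with_eigvals C lC lC (- 2 * lC)"
  obtains l1 l2 l3 where "l2 \<le> l1" "l3 \<le> l2" "eigvals (A + B + C) = triple l1 l2 l3"
    "rank_one_sum_spectrum (- 3 * lA) (- 3 * lB) (- 3 * lC)
      (l1 - (lA + lB + lC)) (l2 - (lA + lB + lC)) (l3 - (lA + lB + lC))"
proof -
  have cA: "A \<in> carrier_mat 3 3" "hermitian A" and cB: "B \<in> carrier_mat 3 3" "hermitian B"
    and cC: "C \<in> carrier_mat 3 3" "hermitian C"
    using A B C by (auto simp: hermitian3_with_eigvals_def)
  let ?X = "A + B + C"
  have AB: "A + B \<in> carrier_mat 3 3" and X: "?X \<in> carrier_mat 3 3" "hermitian ?X"
    using cA cB cC by (auto intro!: hermitian_add)
  obtain l1 l2 l3 where l: "l1 \<ge> l2" "l2 \<ge> l3" and ev: "hermitian3_with_eigvals ?X l1 l2 l3"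
    by (rule hermitian3_ordered_eigvals[OF X])
  obtain U where U: "U \<in> carrier_mat 3 3" "mat_adjoint U * U = 1\<^sub>m 3" "U * mat_adjoint U = 1\<^sub>m 3"
    and F: "\<forall>x\<in>carrier_vec 3. herm_form ?X x =
      l1 * (cmod (x \<bullet>c col U 0))\<^sup>2 + l2 * (cmod (x \<bullet>c col U 1))\<^sup>2 + l3 * (cmod (x \<bullet>c col U 2))\<^sup>2"
    and N: "\<forall>x\<in>carrier_vec 3. norm_sq x =
      (cmod (x \<bullet>c col U 0))\<^sup>2 + (cmod (x \<bullet>c col U 1))\<^sup>2 + (cmod (x \<bullet>c col U 2))\<^sup>2"
    by (rule hermitian3_spectral[OF ev])
  obtain u where u: "u \<in> carrier_vec 3" "norm_sq u = 1"
    "\<forall>x\<in>carrier_vec 3. herm_form A x = lA * norm_sq x - 3 * lA * (cmod (x \<bullet>c u))\<^sup>2"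
    by (rule rank_one_form[OF A])
  obtain v where v: "v \<in> carrier_vec 3" "norm_sq v = 1"
    "\<forall>x\<in>carrier_vec 3. herm_form B x = lB * norm_sq x - 3 * lB * (cmod (x \<bullet>c v))\<^sup>2"
    by (rule rank_one_form[OF B])
  obtain w where w: "w \<in> carrier_vec 3" "norm_sq w = 1"
    "\<forall>x\<in>carrier_vec 3. herm_form C x = lC * norm_sq x - 3 * lC * (cmod (x \<bullet>c w))\<^sup>2"
    by (rule rank_one_form[OF C])
  have uvw: "u \<in> unit3" "v \<in> unit3" "w \<in> unit3" using u(1,2) v(1,2) w(1,2) by (simp_all add: unit3_def)
  have y: "col U i \<in> unit3" if "i < 3" for i
  proof -
    have "col U i \<in> carrier_vec 3" using U(1) by (simp add: carrier_vecI)
    then show ?thesis using norm_sq_col_unitary[OF U(1,2) that] unfolding unit3_def by blast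
  qed
  define L where "L = lA + lB + lC"
  have "rank_one_sum_spectrum (- 3 * lA) (- 3 * lB) (- 3 * lC) (l1 - L) (l2 - L) (l3 - L)"
  proof (rule rank_one_sum_spectrumI[OF uvw])
    show "col U 0 \<in> unit3" "col U 1 \<in> unit3" "col U 2 \<in> unit3" by (rule y, simp)+
    fix x :: "complex vec" assume x: "x \<in> carrier_vec 3"
    show "norm_sq x = (cmod (x \<bullet>c col U 0))\<^sup>2 + (cmod (x \<bullet>c col U 1))\<^sup>2 + (cmod (x \<bullet>c col U 2))\<^sup>2"
      by (rule bspec[OF N x])
    have "herm_form ?X x = herm_form A x + herm_form B x + herm_form C x"
      using herm_form_add[OF AB cC(1) x] herm_form_add[OF cA(1) cB(1) x] by simp
    then have e: "l1 * (cmod (x \<bullet>c col U 0))\<^sup>2 + l2 * (cmod (x \<bullet>c col U 1))\<^sup>2 + l3 * (cmod (x \<bullet>c col U 2))\<^sup>2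
      = L * norm_sq x - 3 * lA * (cmod (x \<bullet>c u))\<^sup>2 - 3 * lB * (cmod (x \<bullet>c v))\<^sup>2 - 3 * lC * (cmod (x \<bullet>c w))\<^sup>2"
      unfolding bspec[OF F x] bspec[OF u(3) x] bspec[OF v(3) x] bspec[OF w(3) x] L_def by (simp add: distrib_right)
    show "(l1 - L) * (cmod (x \<bullet>c col U 0))\<^sup>2 + (l2 - L) * (cmod (x \<bullet>c col U 1))\<^sup>2 + (l3 - L) * (cmod (x \<bullet>c col U 2))\<^sup>2 =
       - 3 * lA * (cmod (x \<bullet>c u))\<^sup>2 + - 3 * lB * (cmod (x \<bullet>c v))\<^sup>2 + - 3 * lC * (cmod (x \<bullet>c w))\<^sup>2"
      using e unfolding bspec[OF N x] left_diff_distrib distrib_left by linarith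
  qed
  moreover have "eigvals ?X = triple l1 l2 l3" using ev by (simp add: hermitian3_with_eigvals_def)
  ultimately show thesis using that[OF l] unfolding L_def by blast
qed

lemma hermitian3_three_sum_in_polytope:
  assumes nz: "lA \<noteq> 0" "lB \<noteq> 0" "lC \<noteq> 0"
    and "hermitian3_with_eigvals A lA lA (- 2 * lA)" "hermitian3_with_eigvals B lB lB (- 2 * lB)"
      "hermitian3_with_eigvals C lC lC (- 2 * lC)"
  obtains l1 l2 l3 where "l2 \<le> l1" "l3 \<le> l2" "eigvals (A + B + C) = triple l1 l2 l3"
    "vector [l1, l2, l3] \<in> polytope_P (- 3 * lA) (- 3 * lB) (- 3 * lC)"
proof -
  define L where "L = lA + lB + lC"
  obtain l1 l2 l3 where l: "l2 \<le> l1" "l3 \<le> l2" "eigvals (A + B + C) = triple l1 l2 l3"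
    and S: "rank_one_sum_spectrum (- 3 * lA) (- 3 * lB) (- 3 * lC) (l1 - L) (l2 - L) (l3 - L)"
    unfolding L_def by (rule hermitian3_sum_spectrum[OF assms(4-6)])
  \<comment> \<open>All premises are carried inside \<open>P\<close> because they are symmetric in
    the weights only jointly; the ordered eigenvalues stay fixed while the weights are
    permuted.\<close>
  define P where "P g1 g2 g3 \<longleftrightarrow> (g1 \<noteq> 0 \<longrightarrow> g2 \<noteq> 0 \<longrightarrow> g3 \<noteq> 0 \<longrightarrow> - 3 * L = g1 + g2 + g3 \<longrightarrow>
    rank_one_sum_spectrum g1 g2 g3 (l1 - L) (l2 - L) (l3 - L) \<longrightarrow> vector [l1, l2, l3] \<in> polytope_P g1 g2 g3)"
    for g1 g2 g3
  have "P (- 3 * lA) (- 3 * lB) (- 3 * lC)"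
  proof (rule sorted_triple_cases[of P])
    fix a b c :: real
    show "P a b c" if ord: "b \<le> a" "c \<le> b"
      unfolding P_def
    proof (intro impI)
      assume nz: "a \<noteq> 0" "b \<noteq> 0" "c \<noteq> 0" and L: "- 3 * L = a + b + c"
        and S: "rank_one_sum_spectrum a b c (l1 - L) (l2 - L) (l3 - L)"
      have "weyl_region a b c (l1 - L) (l2 - L) (l3 - L)"
        using rank_one_sum_spectrum_weyl_region[OF S _ _ ord nz] l by simp
      moreover have "(a + b + c) / 3 = - L" using L by simp
      ultimately show "vector [l1, l2, l3] \<in> polytope_P a b c"
        using polytope_P_iff[OF ord nz, of l1 l2 l3] by (simp only: add_uminus_conv_diff)
    qed
    have "polytope_P b a c = polytope_P a b c" "polytope_P a c b = polytope_P a b c"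
      by (rule polytope_P_permute, simp add: add_mset_commute)+
    then show "P b a c" "P a c b" if "P a b c"
      using that rank_one_sum_spectrum_swap12[of b a c] rank_one_sum_spectrum_swap23[of a c b]
      unfolding P_def by (auto simp: add_ac)
  qed
  then show thesis using that[OF l] S nz by (simp add: P_def L_def)
qed

lemma triple_permute: "mset [a, b, c] = mset [x, y, z] \<Longrightarrow> triple a b c = triple x y z"
proof -
  assume "mset [a, b, c] = mset [x, y, z]"
  then have "image_mset complex_of_real (mset [a, b, c]) = image_mset complex_of_real (mset [x, y, z])" by simp
  then show ?thesis by (simp add: triple_def)
qed

definition realizable :: "real \<Rightarrow> real \<Rightarrow> real \<Rightarrow> real \<Rightarrow> real \<Rightarrow> real \<Rightarrow> bool" where
  "realizable lA lB lC l1 l2 l3 \<longleftrightarrow> (\<exists>A B C. hermitian3_with_eigvals A lA lA (- 2 * lA) \<and>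
     hermitian3_with_eigvals B lB lB (- 2 * lB) \<and> hermitian3_with_eigvals C lC lC (- 2 * lC) \<and>
     eigvals (A + B + C) = triple l1 l2 l3)"

lemma realizable_swap12:
  assumes "realizable lA lB lC l1 l2 l3"
  shows "realizable lB lA lC l1 l2 l3"
proof -
  obtain A B C where *: "hermitian3_with_eigvals A lA lA (- 2 * lA)" "hermitian3_with_eigvals B lB lB (- 2 * lB)"
    "hermitian3_with_eigvals C lC lC (- 2 * lC)" "eigvals (A + B + C) = triple l1 l2 l3"
    using assms unfolding realizable_def by blast
  then have "B + A = A + B"
    by (intro comm_add_mat[of _ 3 3]) (simp_all add: hermitian3_with_eigvals_def)
  with * show ?thesis unfolding realizable_def by metis
qed

lemma realizable_swap23:
  assumes "realizable lA lB lC l1 l2 l3"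
  shows "realizable lA lC lB l1 l2 l3"
proof -
  obtain A B C where *: "hermitian3_with_eigvals A lA lA (- 2 * lA)" "hermitian3_with_eigvals B lB lB (- 2 * lB)"
    "hermitian3_with_eigvals C lC lC (- 2 * lC)" "eigvals (A + B + C) = triple l1 l2 l3"
    using assms unfolding realizable_def by blast
  then have "A \<in> carrier_mat 3 3" "B \<in> carrier_mat 3 3" "C \<in> carrier_mat 3 3"
    by (auto simp: hermitian3_with_eigvals_def)
  then have "A + B + C = A + C + B"
    by (simp add: assoc_add_mat[of _ 3 3] comm_add_mat[of B 3 3 C])
  with * show ?thesis unfolding realizable_def by metis
qed

lemma polytope_imp_realizable:
  assumes nz: "lA \<noteq> 0" "lB \<noteq> 0" "lC \<noteq> 0"
    and "vector [l1, l2, l3] \<in> polytope_P (- 3 * lA) (- 3 * lB) (- 3 * lC)"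
  shows "realizable lA lB lC l1 l2 l3"
proof -
  define P where "P g1 g2 g3 \<longleftrightarrow> (g1 \<noteq> 0 \<longrightarrow> g2 \<noteq> 0 \<longrightarrow> g3 \<noteq> 0 \<longrightarrow> vector [l1, l2, l3] \<in> polytope_P g1 g2 g3 \<longrightarrow>
    realizable (- g1 / 3) (- g2 / 3) (- g3 / 3) l1 l2 l3)" for g1 g2 g3
  have "P (- 3 * lA) (- 3 * lB) (- 3 * lC)"
  proof (rule sorted_triple_cases[of P])
    fix a b c :: real
    show "P a b c" if ord: "b \<le> a" "c \<le> b"
      unfolding P_def
    proof (intro impI)
      assume nz: "a \<noteq> 0" "b \<noteq> 0" "c \<noteq> 0" and P: "vector [l1, l2, l3] \<in> polytope_P a b c"
      define k where "k = (a + b + c) / 3"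
      have "weyl_region a b c (l1 + k) (l2 + k) (l3 + k)"
        using P polytope_P_iff[OF ord nz] by (simp only: k_def)
      then obtain k1 k2 k3 where k: "mset [k1, k2, k3] = mset [l1 + k, l2 + k, l3 + k]"
        and chain: "rank_one_chain a b c k1 k2 k3 \<or> rank_one_chain c b a k1 k2 k3"
        using weyl_region_imp_chain[OF _ ord nz] by metis
      have "mset (map (\<lambda>x. x - k) [k1, k2, k3]) = mset (map (\<lambda>x. x - k) [l1 + k, l2 + k, l3 + k])"
        using k unfolding mset_map by simp
      then have tr: "triple (k1 - k) (k2 - k) (k3 - k) = triple l1 l2 l3"
        by (intro triple_permute) simp
      \<comment> \<open>The shift depends only on the sum of the weights, so the chain in either
        direction is handled at once.\<close>
      have *: "realizable (- x / 3) (- y / 3) (- z / 3) l1 l2 l3"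
        if "rank_one_chain x y z k1 k2 k3" "x \<noteq> 0" "y \<noteq> 0" "x + y + z = a + b + c" for x y z
      proof -
        have "- x / 3 + - y / 3 + - z / 3 = - k"
          using that(4) by (simp add: k_def field_simps)
        then show ?thesis
          using rank_one_mats_with_spectrum[of "- x / 3" "- y / 3" "- z / 3" k1 k2 k3] that(1-3) tr
          unfolding realizable_def by simp metis
      qed
      from chain show "realizable (- a / 3) (- b / 3) (- c / 3) l1 l2 l3"
      proof
        assume "rank_one_chain c b a k1 k2 k3"
        then have "realizable (- c / 3) (- b / 3) (- a / 3) l1 l2 l3" using nz by (intro *) auto
        then show ?thesis using realizable_swap12 realizable_swap23 by blast
      qed (use nz * in blast)
    qed
    have e: "polytope_P b a c = polytope_P a b c" "polytope_P a c b = polytope_P a b c"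
      by (rule polytope_P_permute, simp add: add_mset_commute)+
    assume P: "P a b c"
    show "P b a c" unfolding P_def e
    proof (intro impI)
      assume "b \<noteq> 0" "a \<noteq> 0" "c \<noteq> 0" "vector [l1, l2, l3] \<in> polytope_P a b c"
      then have "realizable (- a / 3) (- b / 3) (- c / 3) l1 l2 l3" using P unfolding P_def by blast
      then show "realizable (- b / 3) (- a / 3) (- c / 3) l1 l2 l3" by (rule realizable_swap12)
    qed
    show "P a c b" unfolding P_def e
    proof (intro impI)
      assume "a \<noteq> 0" "c \<noteq> 0" "b \<noteq> 0" "vector [l1, l2, l3] \<in> polytope_P a b c"
      then have "realizable (- a / 3) (- b / 3) (- c / 3) l1 l2 l3" using P unfolding P_def by blast
      then show "realizable (- a / 3) (- c / 3) (- b / 3) l1 l2 l3" by (rule realizable_swap23)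
    qed
  qed
  then show ?thesis using assms by (simp add: P_def)
qed

section \<open>The sum of two matrices\<close>

lemma rank_one_mat_zero: "rank_one_mat 0 u = 0\<^sub>m 3 3"
  unfolding rank_one_mat_def by (rule eq_matI) auto

lemma hermitian3_zero: "hermitian3_with_eigvals (0\<^sub>m 3 3) 0 0 (- 2 * 0)"
  using rank_one_mat_eigvals[of 1 0 0 0] by (simp add: rank_one_mat_zero)

text \<open>The zero matrix is a third summand of weight \<open>0\<close>. Placed among the other
  weights by sign, it pins the eigenvalue in the same position to \<open>L = lA + lB\<close>: the
  smallest, middle or largest one. The interval follows from a further bound by a weight and from
  the trace.\<close>

lemma hermitian3_two_sum_spectrum:
  assumes nz: "lA \<noteq> 0" "lB \<noteq> 0"
    and A: "hermitian3_with_eigvals A lA lA (- 2 * lA)" and B: "hermitian3_with_eigvals B lB lB (- 2 * lB)"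
  shows "\<exists>l1 l2 l3. eigvals (A + B) = triple l1 l2 l3 \<and> two_sum_triple lA lB l1 l2 l3"
proof -
  define L where "L = lA + lB"
  have AB: "A + B + 0\<^sub>m 3 3 = A + B"
    using A B by (intro right_add_zero_mat) (auto simp: hermitian3_with_eigvals_def)
  obtain l1 l2 l3 where l: "l2 \<le> l1" "l3 \<le> l2" "eigvals (A + B + 0\<^sub>m 3 3) = triple l1 l2 l3"
    and S0: "rank_one_sum_spectrum (- 3 * lA) (- 3 * lB) (- 3 * 0)
      (l1 - (lA + lB + 0)) (l2 - (lA + lB + 0)) (l3 - (lA + lB + 0))"
    by (rule hermitian3_sum_spectrum[OF A B hermitian3_zero])
  have S: "rank_one_sum_spectrum (- 3 * lA) (- 3 * lB) 0 (l1 - L) (l2 - L) (l3 - L)"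
    using S0 by (simp only: L_def add_0_right mult_zero_right)
  have ord: "l2 - L \<le> l1 - L" "l3 - L \<le> l2 - L" using l by auto
  have sum: "l1 + l2 + l3 = 0"
    using rank_one_sum_spectrum_trace[OF S] by (simp add: L_def)
  have neg: "rank_one_sum_spectrum 0 (3 * lB) (3 * lA) (L - l3) (L - l2) (L - l1)"
    using rank_one_sum_spectrum_uminus[OF S] by simp
  have ord': "L - l2 \<le> L - l3" "L - l1 \<le> L - l2" using l by auto
  \<comment> \<open>\<open>x\<close> is the eigenvalue to be placed in the interval, not necessarily
    the middle one. The interval lies below \<open>L\<close> for \<open>lB > 0\<close> and above it
    for \<open>lB < 0\<close>, which decides the choice of \<open>x\<close> when \<open>L\<close> is
    the middle eigenvalue.\<close>
  have fin: ?thesis if "triple l1 l2 l3 = triple L x y" "x + y = - L"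
    "x \<in> (if lB > 0 then {lA - 2 * lB..L} else {L..lA - 2 * lB})" for x y
    using that l(3) AB by (intro exI[of _ L] exI[of _ x] exI[of _ y]) (auto simp: two_sum_triple_def L_def)
  consider "lA < 0" "lB < 0" | "lA < 0" "lB > 0" | "lA > 0" "lB < 0" | "lA > 0" "lB > 0"
    using nz by linarith
  then show ?thesis
  proof cases
    case 1
    note r = rank_one_sum_spectrum_nonneg[OF S ord]
    have "l3 = L" "- 3 * lA \<le> l1 - L" "0 \<le> l2 - L" using r 1 ord by auto
    then show ?thesis
      using 1 sum by (intro fin[of l2 l1] triple_permute) (auto simp: L_def add_mset_commute)
  next
    case 2
    note r = rank_one_sum_spectrum_mixed[OF rank_one_sum_spectrum_swap23[OF S] ord]
    have "l2 = L" "- 3 * lB \<le> l3 - L" "l3 \<le> L" using r 2 by auto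
    then show ?thesis
      using 2 sum by (intro fin[of l3 l1] triple_permute) (auto simp: L_def add_mset_commute)
  next
    case 3
    note r = rank_one_sum_spectrum_mixed[OF rank_one_sum_spectrum_swap23[OF rank_one_sum_spectrum_swap12[OF S]] ord]
    have "l2 = L" "- 3 * lA \<le> l3 - L" "l2 \<le> l1" using r 3 l by auto
    then show ?thesis
      using 3 sum by (intro fin[of l1 l3] triple_permute) (auto simp: L_def add_mset_commute)
  next
    case 4
    note r = rank_one_sum_spectrum_nonneg[OF rank_one_sum_spectrum_swap12[OF rank_one_sum_spectrum_swap23[OF
      rank_one_sum_spectrum_swap12[OF neg]]] ord']
    have "l1 = L" "3 * lA \<le> L - l3" "0 \<le> L - l2" using r 4 ord' by auto
    then show ?thesis
      using 4 sum by (intro fin[of l2 l3] triple_permute) (auto simp: L_def add_mset_commute)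
  qed
qed

lemma two_sum_triple_realizable:
  assumes nz: "lA \<noteq> 0" "lB \<noteq> 0" and le: "\<bar>lB\<bar> \<le> \<bar>lA\<bar>" and t: "two_sum_triple lA lB l1 l2 l3"
  shows "\<exists>A B. hermitian3_with_eigvals A lA lA (- 2 * lA) \<and> hermitian3_with_eigvals B lB lB (- 2 * lB) \<and>
    eigvals (A + B) = triple l1 l2 l3"
proof -
  define L where "L = lA + lB"
  define g1 g2 where g_def: "g1 = - 3 * lA" "g2 = - 3 * lB"
  define m1 m2 where m_def: "m1 = l2 - L" "m2 = l3 - L"
  have sum: "g1 + g2 = m1 + m2" and l1: "l1 = L"
    using t by (auto simp: two_sum_triple_def g_def m_def L_def)
  have m1: "0 \<le> m1 \<and> m1 \<le> g2 \<or> g2 \<le> m1 \<and> m1 \<le> 0"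
    using t by (auto simp: two_sum_triple_def g_def m_def L_def split: if_splits)
  have "0 \<le> m1 * (g2 - m1)" using m1 by (auto simp: zero_le_mult_iff)
  \<comment> \<open>This is where the size condition enters: \<open>m2 = g1 + (g2 - m1)\<close>, and
    both \<open>m1\<close> and \<open>g2 - m1\<close> are at most \<open>|g2| <= |g1|\<close> in
    absolute value, so neither \<open>m2\<close> nor \<open>g1 - m1\<close> has the sign opposite to
    \<open>g1\<close>.\<close>
  moreover have "0 \<le> m2 * (g1 - m1)"
    using m1 sum le by (auto simp: zero_le_mult_iff g_def)
  ultimately have "0 \<le> (m1 * (g2 - m1)) * (m2 * (g1 - m1))" by (rule mult_nonneg_nonneg)
  also have "\<dots> = (m1 * m2) * ((g1 - m1) * (g2 - m1))" by (simp only: mult_ac)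
  also have "(g1 - m1) * (g2 - m1) = g1 * g2 - m1 * (g1 + g2 - m1)" by (simp add: algebra_simps)
  also have "g1 + g2 - m1 = m2" using sum by simp
  finally have "between_0 (m1 * m2) (g1 * g2)" by (simp add: between_0_def)
  \<comment> \<open>With third weight \<open>0\<close> the second stage changes nothing:
    \<open>m1\<close> and \<open>0\<close> are kept, and the shift turns this \<open>0\<close> into
    \<open>l1 = lA + lB\<close>.\<close>
  then have "rank_one_chain g1 g2 0 m1 0 m2"
    using sum unfolding rank_one_chain_def by (intro exI[of _ m1]) (simp add: between_0_def)
  then have "rank_one_chain (- 3 * lA) (- 3 * lB) (- 3 * 0) m1 0 m2" by (simp add: g_def)
  from rank_one_mats_with_spectrum[OF nz this] obtain u v w where
    A: "hermitian3_with_eigvals (rank_one_mat lA u) lA lA (- 2 * lA)"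
    and B: "hermitian3_with_eigvals (rank_one_mat lB v) lB lB (- 2 * lB)"
    and ev: "eigvals (rank_one_mat lA u + rank_one_mat lB v + rank_one_mat 0 w) =
      triple (m1 + (lA + lB + 0)) (0 + (lA + lB + 0)) (m2 + (lA + lB + 0))" by blast
  have "rank_one_mat lA u + rank_one_mat lB v + rank_one_mat 0 w = rank_one_mat lA u + rank_one_mat lB v"
    using A B by (simp add: rank_one_mat_zero hermitian3_with_eigvals_def right_add_zero_mat[of _ 3 3])
  moreover have "triple (m1 + (lA + lB + 0)) (0 + (lA + lB + 0)) (m2 + (lA + lB + 0)) = triple l1 l2 l3"
    using l1 by (intro triple_permute) (simp add: m_def L_def add_mset_commute)
  ultimately show ?thesis using A B ev by metis
qed

theorem theorem1p1:
  fixes lA lB :: real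
  assumes "lA \<noteq> 0" and "lB \<noteq> 0"
  shows
    "(\<forall>A B. hermitian3_with_eigvals A lA lA (- 2 * lA) \<and>
            hermitian3_with_eigvals B lB lB (- 2 * lB) \<longrightarrow>
        (\<exists>l1 l2 l3. eigvals (A + B) = triple l1 l2 l3 \<and> two_sum_triple lA lB l1 l2 l3)) \<and>
    (\<bar>lB\<bar> \<le> \<bar>lA\<bar> \<longrightarrow>
      (\<forall>l1 l2 l3. two_sum_triple lA lB l1 l2 l3 \<longrightarrow>
        (\<exists>A B. hermitian3_with_eigvals A lA lA (- 2 * lA) \<and>
               hermitian3_with_eigvals B lB lB (- 2 * lB) \<and>
               eigvals (A + B) = triple l1 l2 l3))) \<and>
    (\<forall>lC. lC \<noteq> 0 \<longrightarrow>
      (\<forall>A B C. hermitian3_with_eigvals A lA lA (- 2 * lA) \<and>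
               hermitian3_with_eigvals B lB lB (- 2 * lB) \<and>
               hermitian3_with_eigvals C lC lC (- 2 * lC) \<longrightarrow>
        (\<exists>l1 l2 l3. l1 \<ge> l2 \<and> l2 \<ge> l3 \<and> eigvals (A + B + C) = triple l1 l2 l3 \<and>
           vector [l1, l2, l3] \<in> polytope_P (- 3 * lA) (- 3 * lB) (- 3 * lC)))) \<and>
    (\<forall>lC. lC \<noteq> 0 \<longrightarrow>
      (\<forall>l1 l2 l3. vector [l1, l2, l3] \<in> polytope_P (- 3 * lA) (- 3 * lB) (- 3 * lC) \<longrightarrow>
        (\<exists>A B C. hermitian3_with_eigvals A lA lA (- 2 * lA) \<and>
                 hermitian3_with_eigvals B lB lB (- 2 * lB) \<and>
                 hermitian3_with_eigvals C lC lC (- 2 * lC) \<and>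
                 eigvals (A + B + C) = triple l1 l2 l3)))"
proof (intro conjI allI impI)
  fix lC l1 l2 l3
  assume "lC \<noteq> 0" "vector [l1, l2, l3] \<in> polytope_P (- 3 * lA) (- 3 * lB) (- 3 * lC)"
  then show "\<exists>A B C. hermitian3_with_eigvals A lA lA (- 2 * lA) \<and>
                 hermitian3_with_eigvals B lB lB (- 2 * lB) \<and>
                 hermitian3_with_eigvals C lC lC (- 2 * lC) \<and>
                 eigvals (A + B + C) = triple l1 l2 l3"
    using polytope_imp_realizable assms by (simp add: realizable_def)
next
  fix lC A B C
  assume "lC \<noteq> 0" "hermitian3_with_eigvals A lA lA (- 2 * lA) \<and>
               hermitian3_with_eigvals B lB lB (- 2 * lB) \<and>
               hermitian3_with_eigvals C lC lC (- 2 * lC)"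
  then show "\<exists>l1 l2 l3. l1 \<ge> l2 \<and> l2 \<ge> l3 \<and> eigvals (A + B + C) = triple l1 l2 l3 \<and>
           vector [l1, l2, l3] \<in> polytope_P (- 3 * lA) (- 3 * lB) (- 3 * lC)"
    using hermitian3_three_sum_in_polytope[OF assms, of lC A B C] by metis
qed (use assms hermitian3_two_sum_spectrum two_sum_triple_realizable in blast)+

end
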